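(* Let $X$ be an infinite dimensional complex Banach space and let $T\in L(X)$. The following conditions are equivalent: (i) $T$ is generalized Drazin invertible; (ii) $T$ admits a generalized Kato decomposition and $0$ is not an interior point of $\sigma(T)$; (iii) $T$ admits a generalized Kato decomposition and $0$ is not an interior point of $\sigma_{\mathcal{B}}(T)$; (iv) $T$ admits a generalized Kato decomposition and $0$ is not an accumulation point of $\sigma_{\mathcal{B}}(T)$; (v) there exists $(M,N)\in Red(T)$ such that $T_M$ is Browder and $T_N$ is quasinilpotent; (vi) there exists a bounded projection $P$ on $X$ which commutes with $T$ such that $T+P$ is Browder and $TP$ is quasinilpotent.
   Context: $L(Y)$ is the algebra of bounded linear operators on a Banach space $Y$ (finite dimensional or zero spaces allowed for $Y$); $T-\lambda$ means $T-\lambda I$; $\sigma(T)$ is the usual spectrum; $N(S)$, $R(S)$ denote kernel and range of $S\in L(Y)$. $S$ is quasinilpotent if $\|S^n\|^{1/n}\to0$. $T\in L(X)$ is generalized Drazin invertible if there is $B\in L(X)$ with $TB=BT$, $BTB=B$ and $TBT-T$ quasinilpotent. $S$ is upper semi-Fredholm if $R(S)$ is closed and $\dim N(S)<\infty$, lower semi-Fredholm if $\operatorname{codim}R(S)<\infty$. $\operatorname{asc}(S)=\inf\{n\ge0:N(S^n)=N(S^{n+1})\}$, $\operatorname{dsc}(S)=\inf\{n\ge0:R(S^n)=R(S^{n+1})\}$ ($\inf\emptyset=\infty$). $S$ is upper semi-Browder if it is upper semi-Fredholm with $\operatorname{asc}(S)<\infty$, lower semi-Browder if it is lower semi-Fredholm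 with $\operatorname{dsc}(S)<\infty$, and Browder if it is both upper and lower semi-Browder. $\sigma_{\mathcal{B}}(T)=\{\lambda\in\mathbb{C}:T-\lambda\text{ is not Browder}\}$. $(M,N)\in Red(T)$ means that $M,N$ are closed $T$-invariant subspaces of $X$ with $X=M\oplus N$; $T_M\in L(M)$, $T_N\in L(N)$ are the restrictions of $T$. $S\in L(Y)$ is Kato if $R(S)$ is closed and $N(S)\subset R(S^n)$ for all $n\ge 0$. $T$ admits a generalized Kato decomposition if there is $(M,N)\in Red(T)$ such that $T_M$ is Kato and $T_N$ is quasinilpotent. *)

theory Defs
  imports "HOL-Analysis.Analysis" "HOL-Library.Extended_Nat"
begin

section \<open>Complex Banach spaces\<close>

class complex_normed_vector = real_normed_vector +
  fixes scaleC :: "complex \<Rightarrow> 'a \<Rightarrow> 'a"  (infixr "*\<^sub>C" 75)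
  assumes scaleC_add_right: "c *\<^sub>C (x + y) = c *\<^sub>C x + c *\<^sub>C y"
    and scaleC_add_left: "(c + d) *\<^sub>C x = c *\<^sub>C x + d *\<^sub>C x"
    and scaleC_scaleC: "c *\<^sub>C (d *\<^sub>C x) = (c * d) *\<^sub>C x"
    and scaleC_of_real: "complex_of_real r *\<^sub>C x = r *\<^sub>R x"
    and norm_scaleC: "norm (c *\<^sub>C x) = cmod c * norm x"

class complex_banach = complex_normed_vector + banach

instantiation complex :: complex_banach
begin
definition scaleC_complex :: "complex \<Rightarrow> complex \<Rightarrow> complex"
  where "scaleC_complex c x = c * x"
instance
  by standard (auto simp: scaleC_complex_def algebra_simps norm_mult scaleR_conv_of_real)
end

global_interpretation complex_vector:
  vector_space "scaleC :: complex \<Rightarrow> 'a \<Rightarrow> 'a::complex_normed_vector"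
proof
  fix x :: 'a
  show "1 *\<^sub>C x = x"
    using scaleC_of_real[of 1 x] by simp
qed (simp_all add: scaleC_add_right scaleC_add_left scaleC_scaleC)

definition finite_dim :: "'a::complex_normed_vector set \<Rightarrow> bool"
  where "finite_dim V \<longleftrightarrow> (\<exists>B. finite B \<and> V = complex_vector.span B)"

text \<open>For a subspace \<open>V\<close> of \<open>Y\<close>: the quotient of \<open>Y\<close> by \<open>V\<close> has finite dimension.\<close>

definition finite_codim_in :: "'a::complex_normed_vector set \<Rightarrow> 'a set \<Rightarrow> bool"
  where "finite_codim_in Y V \<longleftrightarrow>
    (\<exists>B. finite B \<and> B \<subseteq> Y \<and> Y = complex_vector.span (V \<union> B))"

definition bounded_clinear :: "('a::complex_normed_vector \<Rightarrow> 'b::complex_normed_vector) \<Rightarrow> bool"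
  where "bounded_clinear f \<longleftrightarrow> bounded_linear f \<and> (\<forall>c x. f (c *\<^sub>C x) = c *\<^sub>C f x)"


section \<open>Operators on a closed invariant subspace\<close>

text \<open>
  The notions below concern an operator in \<open>L(Y)\<close>, where \<open>Y\<close> is a closed subspace of the
  ambient space. The operator is given by a bounded linear map \<open>S\<close> on the whole space with
  \<open>S ` Y \<subseteq> Y\<close>; only its values on \<open>Y\<close> matter, so that the notion for \<open>Y\<close> and \<open>S\<close> is the one
  for the restriction of \<open>S\<close> to \<open>Y\<close>. Operators on the whole space are the case \<open>Y = UNIV\<close>.
  As \<open>Y\<close> is closed, a subset of \<open>Y\<close> is closed in \<open>Y\<close> iff it is closed.
\<close>

definition kernel_on :: "'a set \<Rightarrow> ('a \<Rightarrow> 'a::complex_banach) \<Rightarrow> 'a set"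
  where "kernel_on Y S = {x \<in> Y. S x = 0}"

text \<open>The operator norm on \<open>Y\<close>; \<open>onorm\<close> is the case \<open>Y = UNIV\<close>.\<close>

definition onorm_on :: "'a set \<Rightarrow> ('a \<Rightarrow> 'a::complex_banach) \<Rightarrow> real"
  where "onorm_on Y S = (SUP x\<in>Y. norm (S x) / norm x)"

definition quasinilpotent_on :: "'a set \<Rightarrow> ('a \<Rightarrow> 'a::complex_banach) \<Rightarrow> bool"
  where "quasinilpotent_on Y S \<longleftrightarrow> (\<lambda>n. root n (onorm_on Y (S ^^ n))) \<longlonglongrightarrow> 0"

definition asc_on :: "'a set \<Rightarrow> ('a \<Rightarrow> 'a::complex_banach) \<Rightarrow> enat"
  where "asc_on Y S = Inf {enat n | n. kernel_on Y (S ^^ n) = kernel_on Y (S ^^ Suc n)}"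

definition dsc_on :: "'a set \<Rightarrow> ('a \<Rightarrow> 'a::complex_banach) \<Rightarrow> enat"
  where "dsc_on Y S = Inf {enat n | n. (S ^^ n) ` Y = (S ^^ Suc n) ` Y}"

definition upper_semi_Fredholm_on :: "'a set \<Rightarrow> ('a \<Rightarrow> 'a::complex_banach) \<Rightarrow> bool"
  where "upper_semi_Fredholm_on Y S \<longleftrightarrow> closed (S ` Y) \<and> finite_dim (kernel_on Y S)"

definition lower_semi_Fredholm_on :: "'a set \<Rightarrow> ('a \<Rightarrow> 'a::complex_banach) \<Rightarrow> bool"
  where "lower_semi_Fredholm_on Y S \<longleftrightarrow> finite_codim_in Y (S ` Y)"

definition upper_semi_Browder_on :: "'a set \<Rightarrow> ('a \<Rightarrow> 'a::complex_banach) \<Rightarrow> bool"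
  where "upper_semi_Browder_on Y S \<longleftrightarrow> upper_semi_Fredholm_on Y S \<and> asc_on Y S < \<infinity>"

definition lower_semi_Browder_on :: "'a set \<Rightarrow> ('a \<Rightarrow> 'a::complex_banach) \<Rightarrow> bool"
  where "lower_semi_Browder_on Y S \<longleftrightarrow> lower_semi_Fredholm_on Y S \<and> dsc_on Y S < \<infinity>"

definition Browder_on :: "'a set \<Rightarrow> ('a \<Rightarrow> 'a::complex_banach) \<Rightarrow> bool"
  where "Browder_on Y S \<longleftrightarrow> upper_semi_Browder_on Y S \<and> lower_semi_Browder_on Y S"

definition Kato_on :: "'a set \<Rightarrow> ('a \<Rightarrow> 'a::complex_banach) \<Rightarrow> bool"
  where "Kato_on Y S \<longleftrightarrow> closed (S ` Y) \<and> (\<forall>n. kernel_on Y S \<subseteq> (S ^^ n) ` Y)"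


section \<open>Operators on the whole space\<close>

definition invertible_op :: "('a \<Rightarrow> 'a::complex_banach) \<Rightarrow> bool"
  where "invertible_op S \<longleftrightarrow> (\<exists>B. bounded_clinear B \<and> S \<circ> B = id \<and> B \<circ> S = id)"

definition spectrum :: "('a \<Rightarrow> 'a::complex_banach) \<Rightarrow> complex set"
  where "spectrum T = {\<mu>. \<not> invertible_op (\<lambda>x. T x - \<mu> *\<^sub>C x)}"

definition Browder_spectrum :: "('a \<Rightarrow> 'a::complex_banach) \<Rightarrow> complex set"
  where "Browder_spectrum T = {\<mu>. \<not> Browder_on UNIV (\<lambda>x. T x - \<mu> *\<^sub>C x)}"

definition generalized_Drazin_invertible :: "('a \<Rightarrow> 'a::complex_banach) \<Rightarrow> bool"
  where "generalized_Drazin_invertible T \<longleftrightarrow>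
    (\<exists>B. bounded_clinear B \<and> T \<circ> B = B \<circ> T \<and> B \<circ> T \<circ> B = B \<and>
         quasinilpotent_on UNIV (\<lambda>x. T (B (T x)) - T x))"

definition Red :: "('a \<Rightarrow> 'a::complex_banach) \<Rightarrow> ('a set \<times> 'a set) set"
  where "Red T = {(M, N).
    complex_vector.subspace M \<and> closed M \<and> T ` M \<subseteq> M \<and>
    complex_vector.subspace N \<and> closed N \<and> T ` N \<subseteq> N \<and>
    M \<inter> N = {0} \<and> {m + n | m n. m \<in> M \<and> n \<in> N} = UNIV}"

definition generalized_Kato_decomposable :: "('a \<Rightarrow> 'a::complex_banach) \<Rightarrow> bool"
  where "generalized_Kato_decomposable T \<longleftrightarrow>
    (\<exists>(M, N) \<in> Red T. Kato_on M T \<and> quasinilpotent_on N T)"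

end

theory Submission
  imports Defs
begin

text \<open>
  All conditions are compared with the existence of a pair \<open>(M, N) \<in> Red T\<close> such that \<open>T\<close> is
  bijective on \<open>M\<close> and quasinilpotent on \<open>N\<close>. For such a pair, \<open>T - \<mu>\<close> is bijective on \<open>M\<close> for
  small \<open>\<mu>\<close> and on \<open>N\<close> for \<open>\<mu> \<noteq> 0\<close>, so \<open>0\<close> is not an accumulation point of the spectrum.
  Conversely, let the restriction of \<open>T\<close> to \<open>M\<close> be Kato, and let \<open>T - \<mu>\<close> be Browder for
  arbitrarily small \<open>\<mu>\<close>. A kernel vector \<open>x \<in> M\<close> of \<open>T\<close> has a backward orbit
  \<open>x = u 0\<close>, \<open>T (u (k + 1)) = u k\<close> of at most geometric growth, and \<open>\<Sum>k. \<mu> ^ k *\<^sub>C u k\<close> is an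
  eigenvector for \<open>\<mu>\<close> that lies in the range of every power of \<open>T - \<mu>\<close>. Finite ascent forces it
  to vanish, hence \<open>x = 0\<close>. So \<open>T\<close> is bounded below on \<open>M\<close>; then \<open>T - \<mu>\<close> is injective with
  finite descent, hence bijective on \<open>M\<close>, and so is its small perturbation \<open>T\<close>.
\<close>

subsection \<open>The open mapping theorem on a closed subspace\<close>

text \<open>The closed image is complete, so by Baire's theorem one of the closed sets
  \<open>C n\<close> has an interior point relative to it. Moving the centre to 0 and rescaling
  yields preimages with an error of at most half the norm, a form that can be iterated.\<close>

lemma dense_image_ball:
  fixes f :: "'a::banach \<Rightarrow> 'b::banach"
  assumes f: "bounded_linear f" and Y: "subspace Y" and cl: "closed (f ` Y)"
  obtains K where "K > 0"
    "\<And>z. z \<in> f ` Y \<Longrightarrow> \<exists>a\<in>Y. norm a \<le> K * norm z \<and> norm (z - f a) \<le> norm z / 2"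
proof -
  interpret f: bounded_linear f by fact
  let ?Z = "f ` Y"
  have Z: "subspace ?Z"
    by (rule linear_subspace_image[OF f.linear_axioms Y])
  define C where "C n = closure (f ` (Y \<inter> cball 0 (real n)))" for n
  have C_sub: "C n \<subseteq> ?Z" for n
    unfolding C_def using cl by (intro closure_minimal) auto
  have "\<exists>n. top_of_set ?Z interior_of C n \<noteq> {}"
  proof (rule ccontr)
    assume "\<nexists>n. top_of_set ?Z interior_of C n \<noteq> {}"
    hence empty: "top_of_set ?Z interior_of C n = {}" for n
      by blast
    have "top_of_set ?Z interior_of \<Union>(range C) = {}"
    proof (rule Baire_category_alt)
      show "completely_metrizable_space (top_of_set ?Z) \<or>
          locally_compact_space (top_of_set ?Z) \<and> regular_space (top_of_set ?Z)"
        using cl by (intro disjI1 completely_metrizable_space_closedin)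
          (auto simp: completely_metrizable_space_euclidean)
      show "closedin (top_of_set ?Z) T \<and> top_of_set ?Z interior_of T = {}" if "T \<in> range C" for T
        using that empty C_sub closed_subset[OF C_sub] by (auto simp: C_def)
    qed auto
    moreover have "\<Union>(range C) = ?Z"
    proof
      show "?Z \<subseteq> \<Union>(range C)"
      proof
        fix z assume "z \<in> ?Z"
        then obtain y where y: "y \<in> Y" "z = f y" by blast
        obtain n :: nat where "norm y \<le> real n" using real_arch_simple by blast
        hence "z \<in> C n"
          unfolding C_def using y closure_subset by fastforce
        thus "z \<in> \<Union>(range C)" by blast
      qed
    qed (use C_sub in auto)
    moreover have "top_of_set ?Z interior_of ?Z = ?Z"
      using interior_of_topspace[of "top_of_set ?Z"] by simp
    ultimately show False
      using subspace_0[OF Z] by auto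
  qed
  then obtain n z0 where "z0 \<in> top_of_set ?Z interior_of C n" by blast
  then obtain U where U: "open U" "z0 \<in> U" "?Z \<inter> U \<subseteq> C n" "z0 \<in> ?Z"
    by (auto simp: interior_of_def openin_open)
  then obtain r where r: "r > 0" "ball z0 r \<subseteq> U"
    using open_contains_ball by blast
  have inC: "z0 + z \<in> C n" if "z \<in> ?Z" "norm z < r" for z
  proof -
    have "z0 + z \<in> ball z0 r" using that by (simp add: dist_norm)
    thus ?thesis using that r U subspace_add[OF Z U(4) that(1)] by blast
  qed
  \<comment> \<open>averaging the approximations of \<open>z0 + z\<close> and of \<open>z0 - z\<close> moves the centre to 0\<close>
  have approx: "\<exists>a\<in>Y. norm a \<le> real n \<and> norm (z - f a) < e"
    if z: "z \<in> ?Z" "norm z < r" and "e > 0" for z e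
  proof -
    have near: "\<exists>a\<in>Y. norm a \<le> n \<and> norm (v - f a) < e" if "v \<in> C n" for v
      using that \<open>e > 0\<close> by (fastforce simp: C_def closure_approachable dist_norm norm_minus_commute)
    obtain a where a: "a \<in> Y" "norm a \<le> n" "norm (z0 + z - f a) < e"
      using near[OF inC[OF z]] by blast
    have "z0 + - z \<in> C n"
      by (rule inC) (use z subspace_neg[OF Z] in auto)
    then obtain b where b: "b \<in> Y" "norm b \<le> n" "norm (z0 + - z - f b) < e"
      using near by blast
    have half_diff: "norm ((1/2) *\<^sub>R (u - v)) \<le> (1/2) * (norm u + norm v)" for u v :: 'b
      by (simp add: norm_triangle_ineq4)
    let ?a = "(1/2) *\<^sub>R (a - b)"
    have "(z0 + z - f a) - (z0 + - z - f b) = (z + z) - (f a - f b)" by simp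
    also have "\<dots> = 2 *\<^sub>R z - f (a - b)" by (simp only: scaleR_2 f.diff)
    finally have "z - f ?a = (1/2) *\<^sub>R ((z0 + z - f a) - (z0 + - z - f b))"
      by (simp only: f.scaleR[of _ "a - b"] scaleR_diff_right[of _ _ "f (a - b)"]) simp
    hence "norm (z - f ?a) \<le> (1/2) * (norm (z0 + z - f a) + norm (z0 + - z - f b))"
      using half_diff by metis
    also have "\<dots> < e"
      using add_strict_mono[OF a(3) b(3)] by simp
    finally have "norm (z - f ?a) < e" .
    moreover have "norm ?a \<le> n"
      using norm_triangle_ineq4[of a b] a b by simp
    moreover have "?a \<in> Y"
      using Y a b by (intro subspace_scale subspace_diff)
    ultimately show ?thesis by blast
  qed
  show ?thesis
  proof
    \<comment> \<open>Since \<open>n\<close> may be 0, the summand 1 keeps the constant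
      positive.\<close>
    show "2 * (real n + 1) / r > 0" using r by simp
    fix z assume z: "z \<in> ?Z"
    show "\<exists>a\<in>Y. norm a \<le> 2 * (real n + 1) / r * norm z \<and> norm (z - f a) \<le> norm z / 2"
    proof (cases "z = 0")
      case True
      thus ?thesis using subspace_0[OF Y] f.zero by (intro bexI[of _ 0]) auto
    next
      case False
      \<comment> \<open>The vector \<open>t *\<^sub>R z\<close> has norm \<open>r / 2\<close>; an
        approximation of it up to \<open>r / 4\<close>, divided by \<open>t\<close>, has error
        \<open>norm z / 2\<close>.\<close>
      define t where "t = r / (2 * norm z)"
      have t: "t > 0" using False r by (simp add: t_def)
      have "norm (t *\<^sub>R z) < r" using False r by (simp add: t_def)
      then obtain a where a: "a \<in> Y" "norm a \<le> n" "norm (t *\<^sub>R z - f a) < r / 4"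
        using approx[of "t *\<^sub>R z" "r/4"] r subspace_scale[OF Z z] by auto
      let ?a = "(1/t) *\<^sub>R a"
      have "z - f ?a = (1/t) *\<^sub>R (t *\<^sub>R z - f a)"
        using t by (simp add: f.scaleR scaleR_diff_right)
      hence "norm (z - f ?a) = (1/t) * norm (t *\<^sub>R z - f a)"
        using t by (simp only: norm_scaleR) simp
      also have "\<dots> \<le> (1/t) * (r/4)"
        using a t by (intro mult_left_mono) auto
      also have "\<dots> = norm z / 2"
        using False r by (simp add: t_def)
      finally have "norm (z - f ?a) \<le> norm z / 2" .
      moreover have "norm ?a \<le> (1/t) * (real n + 1)"
        using a t by (simp add: divide_right_mono)
      moreover have "(1/t) * (real n + 1) = 2 * (real n + 1) / r * norm z"
        using r by (simp add: t_def)
      ultimately show ?thesis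
        using subspace_scale[OF Y a(1)] by (intro bexI[of _ ?a]) auto
    qed
  qed
qed

text \<open>Successive correction: \<open>w k\<close> is the error left after \<open>k\<close>
  approximate preimages, and it is halved at each step. The corrections therefore form an absolutely
  convergent series, whose sum stays in \<open>Y\<close> because \<open>Y\<close> is closed.\<close>

lemma open_mapping:
  fixes f :: "'a::banach \<Rightarrow> 'b::banach"
  assumes f: "bounded_linear f" and Y: "subspace Y" "closed Y" and cl: "closed (f ` Y)"
  obtains K where "K > 0" "\<And>z. z \<in> f ` Y \<Longrightarrow> \<exists>a\<in>Y. f a = z \<and> norm a \<le> K * norm z"
proof -
  interpret f: bounded_linear f by fact
  let ?Z = "f ` Y"
  have Z: "subspace ?Z"
    by (rule linear_subspace_image[OF f.linear_axioms Y(1)])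
  obtain K where K: "K > 0"
    "\<And>z. z \<in> ?Z \<Longrightarrow> \<exists>a\<in>Y. norm a \<le> K * norm z \<and> norm (z - f a) \<le> norm z / 2"
    using dense_image_ball[OF f Y(1) cl] by blast
  then obtain g where g: "\<And>z. z \<in> ?Z \<Longrightarrow> g z \<in> Y"
      "\<And>z. z \<in> ?Z \<Longrightarrow> norm (g z) \<le> K * norm z"
      "\<And>z. z \<in> ?Z \<Longrightarrow> norm (z - f (g z)) \<le> norm z / 2"
    by metis
  show ?thesis
  proof
    \<comment> \<open>The factor 2 is the sum of the geometric series with ratio 1/2.\<close>
    show "2 * K > 0" using K by simp
    fix z assume z: "z \<in> ?Z"
    define w where "w k = ((\<lambda>y. y - f (g y)) ^^ k) z" for k
    have w_Suc: "w (Suc k) = w k - f (g (w k))" and w_0: "w 0 = z" for k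
      by (simp_all add: w_def)
    have wZ: "w k \<in> ?Z" for k
      by (induction k) (use z g in \<open>auto simp: w_Suc w_0 intro!: subspace_diff[OF Z]\<close>)
    have w_le: "norm (w k) \<le> norm z * (1/2)^k" for k
    proof (induction k)
      case (Suc k)
      thus ?case using g(3)[OF wZ, of k] by (simp add: w_Suc)
    qed (simp add: w_0)
    have gw: "norm (g (w k)) \<le> K * norm z * (1/2)^k" for k
      using order_trans[OF g(2)[OF wZ] mult_left_mono[OF w_le]] K by (simp add: mult.assoc)
    have sums: "(\<lambda>k. K * norm z * (1/2)^k) sums (2 * K * norm z)"
      using sums_mult[OF geometric_sums[of "1/2::real"], of "K * norm z"] by (simp add: mult_ac)
    have summ: "summable (\<lambda>k. norm (g (w k)))"
      by (rule summable_comparison_test'[OF sums_summable[OF sums], of 0]) (use gw in simp)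
    define a where "a = (\<Sum>k. g (w k))"
    have a_sums: "(\<lambda>k. g (w k)) sums a"
      unfolding a_def using summable_norm_cancel[OF summ] by (rule summable_sums)
    have "a \<in> Y"
    proof (rule closed_sequentially[OF Y(2)])
      show "(\<lambda>n. \<Sum>k<n. g (w k)) \<longlonglongrightarrow> a" using a_sums by (simp add: sums_def)
      show "\<And>n. (\<Sum>k<n. g (w k)) \<in> Y" using g(1) wZ by (intro subspace_sum[OF Y(1)]) auto
    qed
    moreover have "norm a \<le> 2 * K * norm z"
    proof -
      have "norm a \<le> (\<Sum>k. norm (g (w k)))"
        unfolding a_def by (rule summable_norm[OF summ])
      also have "\<dots> \<le> 2 * K * norm z"
        using suminf_le[OF gw summ sums_summable[OF sums]] sums_unique[OF sums] by simp
      finally show ?thesis .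
    qed
    moreover have "f a = z"
    proof -
      have "(\<lambda>n. \<Sum>k<n. f (g (w k))) \<longlonglongrightarrow> f a"
        using f.sums[OF a_sums] by (simp add: sums_def)
      moreover have "(\<Sum>k<n. f (g (w k))) = z - w n" for n
        by (induction n) (simp_all add: w_0 w_Suc)
      moreover have "w \<longlonglongrightarrow> 0"
      proof (rule Lim_null_comparison)
        show "(\<lambda>k. norm z * (1/2)^k) \<longlonglongrightarrow> 0"
          using tendsto_mult_right_zero[OF LIMSEQ_power_zero[of "1/2::real"]] by simp
      qed (use w_le in simp)
      ultimately have "(\<lambda>n. z - w n) \<longlonglongrightarrow> f a" "(\<lambda>n. z - w n) \<longlonglongrightarrow> z - 0"
        by (simp_all only: tendsto_diff tendsto_const)
      thus ?thesis using LIMSEQ_unique by fastforce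
    qed
    ultimately show "\<exists>a\<in>Y. f a = z \<and> norm a \<le> 2 * K * norm z" by blast
  qed
qed

subsection \<open>Complex linear maps\<close>

lemma bounded_linear_scaleC: "bounded_linear (\<lambda>x::'a::complex_normed_vector. c *\<^sub>C x)"
proof (rule bounded_linear_intro)
  fix r and x :: 'a
  show "c *\<^sub>C (r *\<^sub>R x) = r *\<^sub>R (c *\<^sub>C x)"
    by (simp add: scaleC_scaleC mult.commute flip: scaleC_of_real)
  show "norm (c *\<^sub>C x) \<le> norm x * cmod c"
    by (simp add: norm_scaleC mult.commute)
qed (rule scaleC_add_right)

lemma subspace_of_complex: "complex_vector.subspace V \<Longrightarrow> subspace V"
  by (auto simp: subspace_def complex_vector.subspace_def simp flip: scaleC_of_real)

lemma bounded_clinear_bounded_linear: "bounded_clinear f \<Longrightarrow> bounded_linear f"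
  by (simp add: bounded_clinear_def)

lemma
  assumes "bounded_clinear f"
  shows bounded_clinear_add: "f (x + y) = f x + f y"
    and bounded_clinear_diff: "f (x - y) = f x - f y"
    and bounded_clinear_zero: "f 0 = 0"
    and bounded_clinear_scaleC: "f (c *\<^sub>C x) = c *\<^sub>C f x"
    and bounded_clinear_continuous_on: "continuous_on A f"
  using assms unfolding bounded_clinear_def
  by (auto simp: linear_simps linear_continuous_on)

lemma bounded_clinear_ident: "bounded_clinear (\<lambda>x. x)"
  by (simp add: bounded_clinear_def bounded_linear_ident)

lemma bounded_clinear_compose:
  "bounded_clinear f \<Longrightarrow> bounded_clinear g \<Longrightarrow> bounded_clinear (\<lambda>x. f (g x))"
  by (simp add: bounded_clinear_def bounded_linear_compose)

lemma bounded_clinear_sum: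
  "bounded_clinear f \<Longrightarrow> bounded_clinear g \<Longrightarrow> bounded_clinear (\<lambda>x. f x + g x)"
  by (simp add: bounded_clinear_def bounded_linear_add scaleC_add_right)

lemma bounded_clinear_sub:
  "bounded_clinear f \<Longrightarrow> bounded_clinear g \<Longrightarrow> bounded_clinear (\<lambda>x. f x - g x)"
  by (simp add: bounded_clinear_def bounded_linear_sub complex_vector.scale_right_diff_distrib)

lemma bounded_clinear_scaleC_left: "bounded_clinear (\<lambda>x. c *\<^sub>C x)"
  by (simp add: bounded_clinear_def bounded_linear_scaleC scaleC_scaleC mult.commute)

lemma bounded_clinear_shift: "bounded_clinear f \<Longrightarrow> bounded_clinear (\<lambda>x. f x - \<mu> *\<^sub>C x)"
  by (intro bounded_clinear_sub bounded_clinear_scaleC_left)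

lemma bounded_clinear_funpow:
  fixes f :: "'a::complex_normed_vector \<Rightarrow> 'a"
  shows "bounded_clinear f \<Longrightarrow> bounded_clinear (f ^^ n)"
  by (induction n) (auto simp: bounded_clinear_ident bounded_clinear_compose o_def id_def)

lemma complex_subspace_image:
  assumes "bounded_clinear f" "complex_vector.subspace V"
  shows "complex_vector.subspace (f ` V)"
proof -
  have "f x + f y \<in> f ` V" if "x \<in> V" "y \<in> V" for x y
    using complex_vector.subspace_add[OF assms(2) that] bounded_clinear_add[OF assms(1), of x y]
    by (metis imageI)
  moreover have "c *\<^sub>C f x \<in> f ` V" if "x \<in> V" for x c
    using complex_vector.subspace_scale[OF assms(2) that] bounded_clinear_scaleC[OF assms(1), of c x]
    by (metis imageI)
  moreover have "0 \<in> f ` V"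
    using complex_vector.subspace_0[OF assms(2)] bounded_clinear_zero[OF assms(1)]
    by (metis imageI)
  ultimately show ?thesis by (auto simp: complex_vector.subspace_def)
qed

lemma complex_subspace_kernel:
  assumes "bounded_clinear f"
  shows "complex_vector.subspace {x. f x = 0}"
  using assms by (simp add: complex_vector.subspace_def bounded_clinear_add
      bounded_clinear_zero bounded_clinear_scaleC)

lemma closed_kernel:
  assumes "bounded_clinear f"
  shows "closed {x. f x = 0}"
  by (rule closed_Collect_eq[OF bounded_clinear_continuous_on[OF assms] continuous_on_const])

lemma funpow_in: "S ` Y \<subseteq> Y \<Longrightarrow> x \<in> Y \<Longrightarrow> (S ^^ n) x \<in> Y"
  by (induction n) auto

lemma funpow_kernel_mono:
  fixes S :: "'a::complex_normed_vector \<Rightarrow> 'a"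
  assumes "bounded_clinear S" "m \<le> n" "(S ^^ m) x = 0"
  shows "(S ^^ n) x = 0"
proof -
  have "S ^^ n = (S ^^ (n - m)) \<circ> (S ^^ m)"
    using assms(2) by (simp flip: funpow_add)
  thus ?thesis
    using assms(3) by (simp add: bounded_clinear_zero[OF bounded_clinear_funpow[OF assms(1)]])
qed

section \<open>Bijective operators on closed subspaces\<close>

lemma bij_betw_linearI:
  assumes "bounded_clinear S" "complex_vector.subspace Y" "S ` Y = Y"
    and "\<And>x. x \<in> Y \<Longrightarrow> S x = 0 \<Longrightarrow> x = 0"
  shows "bij_betw S Y Y"
proof (rule bij_betw_imageI)
  show "inj_on S Y"
  proof (rule inj_onI)
    fix x y assume "x \<in> Y" "y \<in> Y" "S x = S y"
    hence "x - y = 0"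
      using assms(4)[of "x - y"] complex_vector.subspace_diff[OF assms(2)]
      by (simp add: bounded_clinear_diff[OF assms(1)])
    thus "x = y" by simp
  qed
qed fact

text \<open>The bounded inverse theorem on \<open>Y\<close>, with \<open>c\<close> the reciprocal of
  a bound for the inverse. This \<open>c\<close> later serves as the radius of admissible
  perturbations.\<close>

lemma bij_betw_bounded_below:
  fixes S :: "'a::complex_banach \<Rightarrow> 'a"
  assumes S: "bounded_clinear S" and Y: "complex_vector.subspace Y" "closed Y"
    and bij: "bij_betw S Y Y"
  obtains c where "c > 0" "\<And>x. x \<in> Y \<Longrightarrow> c * norm x \<le> norm (S x)"
proof -
  have im: "S ` Y = Y" using bij by (rule bij_betw_imp_surj_on)
  obtain K where K: "K > 0" "\<And>z. z \<in> S ` Y \<Longrightarrow> \<exists>a\<in>Y. S a = z \<and> norm a \<le> K * norm z"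
    using open_mapping[OF bounded_clinear_bounded_linear[OF S] subspace_of_complex[OF Y(1)] Y(2)]
      im Y(2) by metis
  show ?thesis
  proof
    show "1 / K > 0" using K by simp
    fix x assume x: "x \<in> Y"
    then obtain a where "a \<in> Y" "S a = S x" "norm a \<le> K * norm (S x)"
      using K(2)[of "S x"] by blast
    moreover from this have "a = x" using bij x by (auto simp: bij_betw_def inj_on_def)
    ultimately show "1 / K * norm x \<le> norm (S x)" using K by (simp add: field_simps)
  qed
qed

text \<open>Linearity of the inverse is algebra and its boundedness is the lower bound for
  \<open>S\<close>. Spectral questions thus become questions of bijectivity, which can be settled on
  summands.\<close>

lemma invertible_op_iff_bij:
  assumes S: "bounded_clinear S"
  shows "invertible_op S \<longleftrightarrow> bij S"
proof
  assume "invertible_op S"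
  thus "bij S" by (auto simp: invertible_op_def intro: o_bij)
next
  assume bij: "bij S"
  obtain c where c: "c > 0" "\<And>x. c * norm x \<le> norm (S x)"
    using bij_betw_bounded_below[OF S complex_vector.subspace_UNIV closed_UNIV bij] by auto
  have SB: "S (inv S x) = x" for x
    using bij by (simp add: bij_is_surj surj_f_inv_f)
  have BS: "inv S (S x) = x" for x
    using bij by (simp add: bij_is_inj)
  have add: "inv S (x + y) = inv S x + inv S y" for x y
    by (metis BS SB bounded_clinear_add[OF S])
  have scale: "inv S (a *\<^sub>C x) = a *\<^sub>C inv S x" for a x
    by (metis BS SB bounded_clinear_scaleC[OF S])
  have "bounded_linear (inv S)"
  proof (rule bounded_linear_intro[OF add])
    show "inv S (r *\<^sub>R x) = r *\<^sub>R inv S x" for r x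
      using scale by (simp flip: scaleC_of_real)
    show "norm (inv S x) \<le> norm x * (1 / c)" for x
      using c(2)[of "inv S x"] c(1) by (simp add: SB field_simps)
  qed
  hence "bounded_clinear (inv S)"
    using scale by (simp add: bounded_clinear_def)
  thus "invertible_op S"
    using SB BS by (auto simp: invertible_op_def fun_eq_iff)
qed


subsection \<open>Reducing pairs and commuting projections\<close>

text \<open>\<open>P\<close> is the projection onto \<open>N\<close> along \<open>M\<close>.
  Commuting with \<open>T\<close> encodes the invariance of both summands, boundedness encodes their
  closedness.\<close>

lemma Red_iff_projection:
  assumes T: "bounded_clinear T"
  shows "(M, N) \<in> Red T \<longleftrightarrow>
    (\<exists>P. bounded_clinear P \<and> P \<circ> P = P \<and> P \<circ> T = T \<circ> P \<and>
      M = {x. P x = 0} \<and> N = {x. P x = x})"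
proof
  assume "(M, N) \<in> Red T"
  hence M: "complex_vector.subspace M" "closed M" "T ` M \<subseteq> M"
    and N: "complex_vector.subspace N" "closed N" "T ` N \<subseteq> N"
    and int: "M \<inter> N = {0}" and sum: "{m + n | m n. m \<in> M \<and> n \<in> N} = UNIV"
    by (auto simp: Red_def)
  have uniq: "m = m' \<and> n = n'"
    if "m + n = m' + n'" "m \<in> M" "m' \<in> M" "n \<in> N" "n' \<in> N" for m n m' n'
  proof -
    have d: "m - m' = n' - n" using that(1) by (simp add: algebra_simps)
    have "m - m' \<in> M" by (intro complex_vector.subspace_diff M that)
    moreover have "m - m' \<in> N" unfolding d by (intro complex_vector.subspace_diff N that)
    ultimately have "m - m' \<in> M \<inter> N" by (rule IntI)
    hence "m = m'" unfolding int by simp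
    thus ?thesis using that(1) by simp
  qed
  have "\<exists>n\<in>N. x - n \<in> M" for x
  proof -
    have "x \<in> {m + n | m n. m \<in> M \<and> n \<in> N}" using sum by simp
    thus ?thesis by force
  qed
  then obtain P where P: "\<And>x. P x \<in> N" "\<And>x. x - P x \<in> M" by metis
  \<comment> \<open>Every identity for \<open>P\<close> below reduces to exhibiting a decomposition,
    by uniqueness.\<close>
  have P_eq: "P x = n" if "x - n \<in> M" "n \<in> N" for x n
    using uniq[of "x - n" n "x - P x" "P x"] that P by simp
  have add: "P (x + y) = P x + P y" for x y
  proof (rule P_eq)
    have "x + y - (P x + P y) = (x - P x) + (y - P y)" by simp
    thus "x + y - (P x + P y) \<in> M"
      using P M complex_vector.subspace_add by metis
  qed (use P N complex_vector.subspace_add in blast)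
  have scale: "P (c *\<^sub>C x) = c *\<^sub>C P x" for c x
    using complex_vector.subspace_scale[OF M(1) P(2)] complex_vector.subspace_scale[OF N(1) P(1)]
    by (intro P_eq) (simp_all flip: complex_vector.scale_right_diff_distrib)
  \<comment> \<open>Addition maps the closed subspace \<open>M \<times> N\<close> of the product
    onto the whole space. The open mapping theorem yields a decomposition of controlled norm, and by
    uniqueness it is the one given by \<open>P\<close>.\<close>
  obtain K where K: "\<And>x. norm (P x) \<le> norm x * K"
  proof -
    let ?f = "\<lambda>z::'a \<times> 'a. fst z + snd z"
    have f: "bounded_linear ?f"
      by (intro bounded_linear_add bounded_linear_fst bounded_linear_snd)
    have im: "?f ` (M \<times> N) = UNIV"
    proof -
      have "x \<in> ?f ` (M \<times> N)" for x
        using P by (intro image_eqI[of _ _ "(x - P x, P x)"]) auto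
      thus ?thesis by blast
    qed
    obtain K where K: "K > 0" "\<And>x. \<exists>a\<in>M \<times> N. ?f a = x \<and> norm a \<le> K * norm x"
      using open_mapping[OF f subspace_Times[OF M(1)[THEN subspace_of_complex]
            N(1)[THEN subspace_of_complex]] closed_Times[OF M(2) N(2)]] im
      by (metis UNIV_I closed_UNIV)
    have "norm (P x) \<le> norm x * K" for x
    proof -
      obtain m n where "m \<in> M" "n \<in> N" "m + n = x" "norm (m, n) \<le> K * norm x"
        using K(2)[of x] by force
      moreover from this have "P x = n" by (intro P_eq) auto
      ultimately show ?thesis
        using norm_snd_le[of n m] by (simp add: mult.commute)
    qed
    thus ?thesis using that by blast
  qed
  have "bounded_linear P"
    by (rule bounded_linear_intro[OF add _ K]) (use scale in \<open>simp flip: scaleC_of_real\<close>)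
  hence "bounded_clinear P"
    using scale by (simp add: bounded_clinear_def)
  moreover have "P (P x) = P x" for x
    using P complex_vector.subspace_0[OF M(1)] by (intro P_eq) auto
  moreover have "P (T x) = T (P x)" for x
    using P M N by (intro P_eq) (auto simp flip: bounded_clinear_diff[OF T])
  moreover have "M = {x. P x = 0}"
  proof -
    have "x \<in> M \<longleftrightarrow> P x = 0" for x
      using P(2)[of x] P_eq[of x 0] complex_vector.subspace_0[OF N(1)] by auto
    thus ?thesis by blast
  qed
  moreover have "N = {x. P x = x}"
  proof -
    have "x \<in> N \<longleftrightarrow> P x = x" for x
      using P(1)[of x] P_eq[of x x] complex_vector.subspace_0[OF M(1)] by auto
    thus ?thesis by blast
  qed
  ultimately show "\<exists>P. bounded_clinear P \<and> P \<circ> P = P \<and> P \<circ> T = T \<circ> P \<and>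
      M = {x. P x = 0} \<and> N = {x. P x = x}"
    by (intro exI[of _ P]) (simp add: fun_eq_iff)
next
  assume "\<exists>P. bounded_clinear P \<and> P \<circ> P = P \<and> P \<circ> T = T \<circ> P \<and>
      M = {x. P x = 0} \<and> N = {x. P x = x}"
  then obtain P where P: "bounded_clinear P" "\<And>x. P (P x) = P x" "\<And>x. P (T x) = T (P x)"
    and M: "M = {x. P x = 0}" and N: "N = {x. P x = x}"
    by (auto simp: fun_eq_iff)
  have N': "N = {x. P x - x = 0}" by (simp add: N)
  have id_P: "bounded_clinear (\<lambda>x. P x - x)"
    by (intro bounded_clinear_sub P(1) bounded_clinear_ident)
  have "complex_vector.subspace N" "closed N" "complex_vector.subspace M" "closed M"
    unfolding N' M by (rule complex_subspace_kernel closed_kernel id_P P(1))+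
  moreover have "T ` M \<subseteq> M" "T ` N \<subseteq> N"
    using P(3) by (auto simp: M N bounded_clinear_zero[OF T])
  moreover have "M \<inter> N = {0}"
    by (auto simp: M N bounded_clinear_zero[OF P(1)])
  moreover have "{m + n | m n. m \<in> M \<and> n \<in> N} = UNIV"
  proof (rule UNIV_eq_I[symmetric])
    fix x
    have "x = (x - P x) + P x" "x - P x \<in> M" "P x \<in> N"
      by (simp_all add: M N P(2) bounded_clinear_diff[OF P(1)])
    thus "x \<in> {m + n | m n. m \<in> M \<and> n \<in> N}" by blast
  qed
  ultimately show "(M, N) \<in> Red T" by (simp add: Red_def)
qed

lemma RedE:
  assumes "bounded_clinear T" "(M, N) \<in> Red T"
  obtains P where "bounded_clinear P" "\<And>x. P (P x) = P x" "\<And>x. P (T x) = T (P x)"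
    "M = {x. P x = 0}" "N = {x. P x = x}"
    "complex_vector.subspace M" "closed M" "T ` M \<subseteq> M"
    "complex_vector.subspace N" "closed N" "T ` N \<subseteq> N"
proof -
  obtain P where P: "bounded_clinear P" "P \<circ> P = P" "P \<circ> T = T \<circ> P"
      "M = {x. P x = 0}" "N = {x. P x = x}"
    using assms Red_iff_projection by blast
  show ?thesis
  proof (rule that[OF P(1) _ _ P(4,5)])
    show "P (P x) = P x" "P (T x) = T (P x)" for x
      using fun_cong[OF P(2), of x] fun_cong[OF P(3), of x] by simp_all
  qed (use assms(2) in \<open>simp_all add: Red_def\<close>)
qed

lemma bij_betw_Red:
  assumes T: "bounded_clinear T" and MN: "(M, N) \<in> Red T"
    and S: "bounded_clinear S" and "bij_betw S M M" "bij_betw S N N"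
  shows "bij S"
proof -
  from T MN obtain P where P: "bounded_clinear P" "\<And>x. P (P x) = P x"
    and M: "M = {x. P x = 0}" and N: "N = {x. P x = x}"
    by (rule RedE) blast
  have split: "x - P x \<in> M" "P x \<in> N" for x
    by (simp_all add: M N P bounded_clinear_diff[OF P(1)])
  have S_in: "S x \<in> M" if "x \<in> M" for x
    using that assms(4) bij_betwE by blast
  have S_in': "S x \<in> N" if "x \<in> N" for x
    using that assms(5) bij_betwE by blast
  show ?thesis
  proof (rule bij_betw_linearI[OF S complex_vector.subspace_UNIV])
    have "x \<in> range S" for x
    proof -
      obtain u v where "S u = x - P x" "S v = P x"
        using split[of x] assms(4,5) by (metis bij_betw_imp_surj_on imageE)
      hence "S (u + v) = x" by (simp add: bounded_clinear_add[OF S])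
      thus ?thesis by blast
    qed
    thus "range S = UNIV" by blast
    fix x assume "S x = 0"
    hence sum0: "S (x - P x) + S (P x) = 0"
      by (simp flip: bounded_clinear_add[OF S])
    \<comment> \<open>As \<open>S\<close> preserves both summands, applying \<open>P\<close>
      isolates the \<open>N\<close> component of \<open>S x\<close>.\<close>
    hence "P (S (x - P x)) + P (S (P x)) = 0"
      by (simp add: bounded_clinear_zero[OF P(1)] flip: bounded_clinear_add[OF P(1)])
    hence "S (P x) = 0"
      using S_in[OF split(1)] S_in'[OF split(2)] by (simp add: M N)
    moreover from this have "S (x - P x) = 0" using sum0 by simp
    moreover have "0 \<in> M" "0 \<in> N" by (simp_all add: M N bounded_clinear_zero[OF P(1)])
    ultimately have "P x = 0" "x - P x = 0"
      using split[of x] assms(4,5) bounded_clinear_zero[OF S] inj_onD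
      unfolding bij_betw_def by metis+
    thus "x = 0" by simp
  qed
qed

subsection \<open>Quasinilpotent operators\<close>

text \<open>Boundedness is what gives the conditionally complete supremum in \<open>onorm_on\<close>
  its meaning. At the zero vector the ratio is 0, by the convention for division.\<close>

lemma bdd_above_ratio:
  assumes "bounded_linear S"
  shows "bdd_above ((\<lambda>x. norm (S x) / norm x) ` Y)"
proof -
  obtain K where "K > 0" "\<And>x. norm (S x) \<le> norm x * K"
    using bounded_linear.pos_bounded[OF assms] by blast
  hence "norm (S x) / norm x \<le> K" for x
    by (cases "x = 0") (simp_all add: field_simps)
  thus ?thesis by (intro bdd_aboveI2)
qed

lemma onorm_on_ge:
  assumes "bounded_linear S" "x \<in> Y"
  shows "norm (S x) \<le> onorm_on Y S * norm x"
proof (cases "x = 0")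
  case True
  thus ?thesis using linear_simps[OF assms(1)] by simp
next
  case False
  have "norm (S x) / norm x \<le> onorm_on Y S"
    unfolding onorm_on_def by (rule cSUP_upper[OF assms(2) bdd_above_ratio[OF assms(1)]])
  thus ?thesis using False by (simp add: field_simps)
qed

lemma onorm_on_le:
  assumes "Y \<noteq> {}" "0 \<le> b" "\<And>x. x \<in> Y \<Longrightarrow> norm (S x) \<le> b * norm x"
  shows "onorm_on Y S \<le> b"
  unfolding onorm_on_def
proof (rule cSUP_least[OF assms(1)])
  fix x assume "x \<in> Y"
  thus "norm (S x) / norm x \<le> b"
    using assms(2) assms(3)[of x] by (cases "x = 0") (simp_all add: field_simps)
qed

lemma onorm_on_nonneg:
  assumes "bounded_linear S" "0 \<in> Y"
  shows "0 \<le> onorm_on Y S"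
  using cSUP_upper[OF assms(2) bdd_above_ratio[OF assms(1)]] by (simp add: onorm_on_def)

text \<open>Trades roots of operator norms for pointwise growth bounds, which pass easily through
  restrictions and projections. The constant \<open>C\<close> depends on \<open>e\<close> alone and
  absorbs the finitely many powers whose root is not yet below \<open>e\<close>.\<close>

lemma quasinilpotent_on_iff:
  assumes S: "bounded_clinear S" and Y: "0 \<in> Y"
  shows "quasinilpotent_on Y S \<longleftrightarrow>
    (\<forall>e>0. \<exists>C. \<forall>n. \<forall>x\<in>Y. norm ((S ^^ n) x) \<le> C * e ^ n * norm x)"
proof -
  have bl: "bounded_linear (S ^^ n)" for n
    by (intro bounded_clinear_bounded_linear bounded_clinear_funpow S)
  define a where "a n = onorm_on Y (S ^^ n)" for n
  have a_nonneg: "0 \<le> a n" for n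
    unfolding a_def by (rule onorm_on_nonneg[OF bl Y])
  show ?thesis unfolding quasinilpotent_on_def a_def[symmetric]
  proof (intro iffI allI impI)
    fix e :: real
    assume lim: "(\<lambda>n. root n (a n)) \<longlonglongrightarrow> 0" and "e > 0"
    from order_tendstoD(2)[OF lim \<open>e > 0\<close>] obtain N where N: "\<And>n. n \<ge> N \<Longrightarrow> root n (a n) < e"
      by (auto simp: eventually_sequentially)
    \<comment> \<open>The sum dominates each quotient up to index \<open>N\<close>; the 1 covers all
      larger indices.\<close>
    define C where "C = 1 + (\<Sum>k\<le>N. a k / e ^ k)"
    have pos: "0 \<le> a k / e ^ k" for k using a_nonneg \<open>e > 0\<close> by simp
    have "a n \<le> C * e ^ n" for n
    proof (cases "n \<le> N")
      case True
      have "a n / e ^ n \<le> (\<Sum>k\<le>N. a k / e ^ k)"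
        by (rule member_le_sum) (use True pos in auto)
      hence "a n / e ^ n \<le> C" by (simp add: C_def)
      thus ?thesis using \<open>e > 0\<close> by (simp add: field_simps)
    next
      case False
      hence "a n = root n (a n) ^ n"
        using a_nonneg by (simp add: real_root_pow_pos2)
      also have "\<dots> \<le> 1 * e ^ n"
        using False N[of n] power_mono[of "root n (a n)" e n] a_nonneg[of n] by simp
      also have "\<dots> \<le> C * e ^ n"
        using sum_nonneg[of "{..N}" "\<lambda>k. a k / e ^ k"] pos \<open>e > 0\<close>
        by (intro mult_right_mono) (auto simp: C_def)
      finally show ?thesis .
    qed
    hence "norm ((S ^^ n) x) \<le> C * e ^ n * norm x" if "x \<in> Y" for n x
      using order_trans[OF onorm_on_ge[OF bl that] mult_right_mono] by (simp add: a_def)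
    thus "\<exists>C. \<forall>n. \<forall>x\<in>Y. norm ((S ^^ n) x) \<le> C * e ^ n * norm x"
      by (intro exI allI ballI)
  next
    assume bound: "\<forall>e>0. \<exists>C. \<forall>n. \<forall>x\<in>Y. norm ((S ^^ n) x) \<le> C * e ^ n * norm x"
    show "(\<lambda>n. root n (a n)) \<longlonglongrightarrow> 0"
    proof (rule LIMSEQ_I)
      fix e :: real assume e: "e > 0"
      \<comment> \<open>Using \<open>e / 2\<close> leaves room for a factor 2, which eventually
        dominates the roots of the positive constant \<open>D\<close>, since these tend to
        1.\<close>
      from bound[rule_format, OF half_gt_zero[OF e]]
      obtain C where C: "\<And>n x. x \<in> Y \<Longrightarrow> norm ((S ^^ n) x) \<le> C * (e/2) ^ n * norm x"
        by auto
      define D where "D = max C 1"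
      have D: "D > 0" by (simp add: D_def)
      have a_le: "a n \<le> D * (e/2) ^ n" for n
        unfolding a_def
      proof (rule onorm_on_le)
        fix x assume "x \<in> Y"
        have "C * (e/2) ^ n * norm x \<le> D * (e/2) ^ n * norm x"
          using e by (intro mult_right_mono) (auto simp: D_def)
        thus "norm ((S ^^ n) x) \<le> D * (e/2) ^ n * norm x"
          using C[OF \<open>x \<in> Y\<close>, of n] by linarith
      qed (use Y D e in auto)
      from order_tendstoD(2)[OF LIMSEQ_root_const[OF D], of 2]
      obtain N where N: "\<And>n. n \<ge> N \<Longrightarrow> root n D < 2"
        by (auto simp: eventually_sequentially)
      have "norm (root n (a n) - 0) < e" if n: "n \<ge> max N 1" for n
      proof -
        have "root n (a n) \<le> root n (D * (e/2) ^ n)"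
          using a_le n by simp
        also have "\<dots> = root n D * (e/2)"
          using n e by (simp add: real_root_mult real_root_power_cancel)
        also have "\<dots> < 2 * (e/2)"
          using N[of n] n e by (intro mult_strict_right_mono) auto
        finally show ?thesis using real_root_ge_zero[OF a_nonneg, of n n] by simp
      qed
      thus "\<exists>N. \<forall>n\<ge>N. norm (root n (a n) - 0) < e" by blast
    qed
  qed
qed

lemma quasinilpotent_onD:
  assumes "quasinilpotent_on Y S" "bounded_clinear S" "0 \<in> Y" "e > 0"
  obtains C where "C > 0" "\<And>n x. x \<in> Y \<Longrightarrow> norm ((S ^^ n) x) \<le> C * e ^ n * norm x"
proof -
  obtain C where C: "\<And>n x. x \<in> Y \<Longrightarrow> norm ((S ^^ n) x) \<le> C * e ^ n * norm x"
    using assms quasinilpotent_on_iff by metis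
  have "norm ((S ^^ n) x) \<le> max C 1 * e ^ n * norm x" if "x \<in> Y" for n x
  proof -
    have "C * e ^ n * norm x \<le> max C 1 * e ^ n * norm x"
      using \<open>e > 0\<close> by (intro mult_right_mono) auto
    thus ?thesis using C[OF that, of n] by linarith
  qed
  thus ?thesis using that[of "max C 1"] by simp
qed

text \<open>Finitely many powers do not matter: their normalised operator norms \<open>L n\<close>
  are added to the constant.\<close>

lemma quasinilpotent_onI:
  assumes S: "bounded_clinear S" and Y: "0 \<in> Y"
    and ev: "\<And>e. e > 0 \<Longrightarrow> \<exists>C N. \<forall>n\<ge>N. \<forall>x\<in>Y. norm ((S ^^ n) x) \<le> C * e ^ n * norm x"
  shows "quasinilpotent_on Y S"
  unfolding quasinilpotent_on_iff[OF S Y]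
proof (intro allI impI)
  fix e :: real assume e: "e > 0"
  from ev[OF e] obtain C N
    where C: "\<And>n x. n \<ge> N \<Longrightarrow> x \<in> Y \<Longrightarrow> norm ((S ^^ n) x) \<le> C * e ^ n * norm x"
    by auto
  have bl: "bounded_linear (S ^^ n)" for n
    by (intro bounded_clinear_bounded_linear bounded_clinear_funpow S)
  define L where "L n = onorm_on Y (S ^^ n) / e ^ n" for n
  have L_nonneg: "0 \<le> L n" for n
    unfolding L_def using onorm_on_nonneg[OF bl Y] e by simp
  define D where "D = \<bar>C\<bar> + sum L {..<N}"
  have "norm ((S ^^ n) x) \<le> D * e ^ n * norm x" if x: "x \<in> Y" for n x
  proof (cases "n \<ge> N")
    case True
    have "C \<le> D" using sum_nonneg[of "{..<N}" L] L_nonneg by (simp add: D_def)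
    hence "C * e ^ n * norm x \<le> D * e ^ n * norm x"
      using e by (intro mult_right_mono) auto
    thus ?thesis using C[OF True x] by linarith
  next
    case False
    hence "L n \<le> sum L {..<N}" by (intro member_le_sum L_nonneg) auto
    hence "L n \<le> D" by (simp add: D_def)
    hence "L n * e ^ n * norm x \<le> D * e ^ n * norm x"
      using e by (intro mult_right_mono) auto
    thus ?thesis using onorm_on_ge[OF bl x, of n] e by (simp add: L_def)
  qed
  thus "\<exists>C. \<forall>n. \<forall>x\<in>Y. norm ((S ^^ n) x) \<le> C * e ^ n * norm x"
    by (intro exI allI ballI)
qed

text \<open>Because \<open>P\<close> is idempotent and commutes with \<open>T\<close>, a positive
  power of the compressed operator is \<open>T ^^ n\<close> after \<open>P\<close>, up to a scalar
  of modulus 1. The scalar \<open>c\<close> is there to cover both \<open>T P\<close> and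
  \<open>T B T - T = - T P\<close>.\<close>

lemma quasinilpotent_compress_iff:
  assumes T: "bounded_clinear T" and P: "bounded_clinear P" "\<And>x. P (P x) = P x"
    and comm: "\<And>x. P (T x) = T (P x)" and c: "cmod c = 1"
  shows "quasinilpotent_on UNIV (\<lambda>x. c *\<^sub>C T (P x)) \<longleftrightarrow> quasinilpotent_on {x. P x = x} T"
proof -
  define W where "W = (\<lambda>x. c *\<^sub>C T (P x))"
  have W: "bounded_clinear W" unfolding W_def
    using bounded_clinear_compose[OF bounded_clinear_scaleC_left bounded_clinear_compose[OF T P(1)]] .
  have zero: "0 \<in> {x. P x = x}" by (simp add: bounded_clinear_zero[OF P(1)])
  have P_pow: "P ((T ^^ n) x) = (T ^^ n) (P x)" for n x
    by (induction n) (simp_all add: comm)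
  have W_pow: "(W ^^ Suc n) x = c ^ Suc n *\<^sub>C (T ^^ Suc n) (P x)" for n x
  proof (induction n)
    case (Suc n)
    have "(W ^^ Suc (Suc n)) x = W (c ^ Suc n *\<^sub>C (T ^^ Suc n) (P x))"
      using Suc by simp
    also have "\<dots> = c ^ Suc (Suc n) *\<^sub>C (T ^^ Suc (Suc n)) (P x)"
      by (simp add: W_def bounded_clinear_scaleC[OF P(1)] bounded_clinear_scaleC[OF T]
          scaleC_scaleC comm P_pow P(2))
    finally show ?case .
  qed (simp add: W_def)
  \<comment> \<open>Exponent 0 is excluded, since \<open>W ^^ 0\<close> is the identity and not
    \<open>P\<close>; the growth bounds below therefore start at 1.\<close>
  have norm_W: "norm ((W ^^ n) x) = norm ((T ^^ n) (P x))" if n: "n \<ge> 1" for n x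
  proof -
    obtain k where "n = Suc k" using n by (cases n) auto
    thus ?thesis using W_pow[of k x] c by (simp add: norm_scaleC norm_power norm_mult)
  qed
  obtain K where K: "K > 0" "\<And>x. norm (P x) \<le> norm x * K"
    using bounded_linear.pos_bounded[OF bounded_clinear_bounded_linear[OF P(1)]] by blast
  show ?thesis unfolding W_def[symmetric]
  proof
    assume qn: "quasinilpotent_on UNIV W"
    show "quasinilpotent_on {x. P x = x} T"
    proof (rule quasinilpotent_onI[OF T zero])
      fix e :: real assume "e > 0"
      then obtain C where C: "\<And>n x. norm ((W ^^ n) x) \<le> C * e ^ n * norm x"
        by (rule quasinilpotent_onD[OF qn W UNIV_I]) blast
      have "\<forall>n\<ge>1. \<forall>x\<in>{x. P x = x}. norm ((T ^^ n) x) \<le> C * e ^ n * norm x"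
      proof (intro allI ballI impI)
        fix n x assume "n \<ge> (1::nat)" "x \<in> {x. P x = x}"
        thus "norm ((T ^^ n) x) \<le> C * e ^ n * norm x"
          using C[where n = n and x = x] norm_W[of n x] by simp
      qed
      thus "\<exists>C N. \<forall>n\<ge>N. \<forall>x\<in>{x. P x = x}. norm ((T ^^ n) x) \<le> C * e ^ n * norm x"
        by (intro exI)
    qed
  next
    assume qn: "quasinilpotent_on {x. P x = x} T"
    show "quasinilpotent_on UNIV W"
    proof (rule quasinilpotent_onI[OF W UNIV_I])
      fix e :: real assume e: "e > 0"
      then obtain C where C: "C > 0"
          "\<And>n x. x \<in> {x. P x = x} \<Longrightarrow> norm ((T ^^ n) x) \<le> C * e ^ n * norm x"
        using quasinilpotent_onD[OF qn T zero] by metis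
      have "norm ((W ^^ n) x) \<le> (C * K) * e ^ n * norm x" if "n \<ge> 1" for n x
      proof -
        have "norm ((W ^^ n) x) \<le> C * e ^ n * norm (P x)"
          unfolding norm_W[OF that] using P(2) by (intro C(2)) simp
        also have "\<dots> \<le> C * e ^ n * (norm x * K)"
          using C(1) e by (intro mult_left_mono K) simp
        finally show ?thesis by (simp add: mult_ac)
      qed
      thus "\<exists>C N. \<forall>n\<ge>N. \<forall>x\<in>UNIV. norm ((W ^^ n) x) \<le> C * e ^ n * norm x"
        by (intro exI[of _ "C * K"] exI[of _ 1]) simp
    qed
  qed
qed


subsection \<open>Perturbation by scalars\<close>

text \<open>Solutions are the fixed points of the map sending \<open>x\<close> to the preimage under
  \<open>A\<close> of \<open>y + \<mu> *\<^sub>C x\<close>, a contraction with ratio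
  \<open>cmod \<mu> / c\<close>.\<close>

lemma bij_betw_shift:
  fixes A :: "'a::complex_banach \<Rightarrow> 'a"
  assumes A: "bounded_clinear A" and Y: "complex_vector.subspace Y" "closed Y"
    and bij: "bij_betw A Y Y"
    and c: "\<And>x. x \<in> Y \<Longrightarrow> c * norm x \<le> norm (A x)" and \<mu>: "cmod \<mu> < c"
  shows "bij_betw (\<lambda>x. A x - \<mu> *\<^sub>C x) Y Y"
proof -
  define G where "G = inv_into Y A"
  have G: "G y \<in> Y" "A (G y) = y" if "y \<in> Y" for y
    using that bij unfolding G_def
    by (simp_all add: bij_betw_def inv_into_into f_inv_into_f)
  have GA: "G (A x) = x" if "x \<in> Y" for x
    using that bij unfolding G_def by (simp add: bij_betw_def)
  have AY: "A x \<in> Y" if "x \<in> Y" for x using bij that bij_betwE by blast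
  have cpos: "c > 0" using \<mu> norm_ge_zero[of \<mu>] by linarith
  have scale: "\<mu> *\<^sub>C x \<in> Y" if "x \<in> Y" for x
    using complex_vector.subspace_scale[OF Y(1) that] .
  have "\<exists>!x. x \<in> Y \<and> A x - \<mu> *\<^sub>C x = y" if y: "y \<in> Y" for y
  proof -
    define F where "F x = G (y + \<mu> *\<^sub>C x)" for x
    have arg: "y + \<mu> *\<^sub>C x \<in> Y" if "x \<in> Y" for x
      by (intro complex_vector.subspace_add Y y scale that)
    have AF: "A (F x) = y + \<mu> *\<^sub>C x" "F x \<in> Y" if "x \<in> Y" for x
      using G[OF arg[OF that]] by (simp_all add: F_def)
    have "\<exists>!x\<in>Y. F x = x"
    proof (rule Banach_fix)
      show "complete Y" using Y(2) by (simp add: complete_eq_closed)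
      show "Y \<noteq> {}" using y by blast
      show "0 \<le> cmod \<mu> / c" "cmod \<mu> / c < 1" using \<mu> cpos by simp_all
      show "F ` Y \<subseteq> Y" using AF(2) by blast
      fix u v assume u: "u \<in> Y" and v: "v \<in> Y"
      have "A (F u - F v) = \<mu> *\<^sub>C (u - v)"
        using AF(1)[OF u] AF(1)[OF v]
        by (simp add: bounded_clinear_diff[OF A] complex_vector.scale_right_diff_distrib)
      hence "c * norm (F u - F v) \<le> cmod \<mu> * norm (u - v)"
        using c[OF complex_vector.subspace_diff[OF Y(1) AF(2)[OF u] AF(2)[OF v]]]
        by (simp add: norm_scaleC)
      thus "dist (F u) (F v) \<le> cmod \<mu> / c * dist u v"
        using cpos by (simp add: dist_norm field_simps)
    qed
    moreover have "F x = x \<longleftrightarrow> A x - \<mu> *\<^sub>C x = y" if "x \<in> Y" for x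
    proof
      assume "F x = x"
      thus "A x - \<mu> *\<^sub>C x = y" using AF(1)[OF that] by simp
    next
      assume "A x - \<mu> *\<^sub>C x = y"
      hence "y + \<mu> *\<^sub>C x = A x" by (simp add: algebra_simps)
      thus "F x = x" using GA[OF that] by (simp add: F_def)
    qed
    ultimately show ?thesis by metis
  qed
  moreover have "A x - \<mu> *\<^sub>C x \<in> Y" if "x \<in> Y" for x
    by (intro complex_vector.subspace_diff Y scale AY that)
  ultimately show ?thesis
    unfolding bij_betw_def inj_on_def by (auto; blast)
qed

text \<open>The equation \<open>S x - \<mu> *\<^sub>C x = y\<close> is the fixed point equation of a map some iterate
  of which is a contraction.\<close>

lemma quasinilpotent_bij_betw_shift:
  assumes S: "bounded_clinear S" and Y: "complex_vector.subspace Y" "closed Y" "S ` Y \<subseteq> Y"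
    and qn: "quasinilpotent_on Y S" and \<mu>: "\<mu> \<noteq> 0"
  shows "bij_betw (\<lambda>x. S x - \<mu> *\<^sub>C x) Y Y"
proof -
  have "0 \<in> Y" by (rule complex_vector.subspace_0[OF Y(1)])
  moreover have "cmod \<mu> / 2 > 0" using \<mu> by simp
  ultimately obtain C where C: "C > 0"
    "\<And>n x. x \<in> Y \<Longrightarrow> norm ((S ^^ n) x) \<le> C * (cmod \<mu> / 2) ^ n * norm x"
    using quasinilpotent_onD[OF qn S] by metis
  \<comment> \<open>The powers of \<open>\<mu>\<close> cancel in the estimate, so the iterate of
    order \<open>n\<close> has Lipschitz constant \<open>C * (1/2) ^ n\<close>, which is below
    1/2.\<close>
  obtain n where n: "(1/2::real) ^ n < 1 / (2 * C)"
    using real_arch_pow_inv[of "1 / (2 * C)" "1/2"] C(1) by auto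
  have "\<exists>!x. x \<in> Y \<and> S x - \<mu> *\<^sub>C x = y" if y: "y \<in> Y" for y
  proof -
    define F where "F x = inverse \<mu> *\<^sub>C (S x - y)" for x
    have F_in: "F x \<in> Y" if "x \<in> Y" for x
      unfolding F_def using that Y(3)
      by (intro complex_vector.subspace_scale complex_vector.subspace_diff Y y) auto
    have diff: "(F ^^ k) u - (F ^^ k) v = inverse \<mu> ^ k *\<^sub>C (S ^^ k) (u - v)" for k u v
    proof (induction k)
      case (Suc k)
      have "(F ^^ Suc k) u - (F ^^ Suc k) v = inverse \<mu> *\<^sub>C S ((F ^^ k) u - (F ^^ k) v)"
        by (simp add: F_def bounded_clinear_diff[OF S] flip: complex_vector.scale_right_diff_distrib)
      thus ?case
        by (simp add: Suc bounded_clinear_scaleC[OF S] scaleC_scaleC)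
    qed simp
    have "\<exists>!x\<in>Y. (F ^^ n) x = x"
    proof (rule Banach_fix)
      show "complete Y" using Y(2) by (simp add: complete_eq_closed)
      show "Y \<noteq> {}" using y by blast
      show "(F ^^ n) ` Y \<subseteq> Y" using F_in funpow_in[of F Y] by blast
      show "0 \<le> (1/2::real)" "(1/2::real) < 1" by simp_all
      fix u v assume "u \<in> Y" "v \<in> Y"
      hence uv: "u - v \<in> Y" by (rule complex_vector.subspace_diff[OF Y(1)])
      have "dist ((F ^^ n) u) ((F ^^ n) v) = inverse (cmod \<mu>) ^ n * norm ((S ^^ n) (u - v))"
        by (simp add: dist_norm diff norm_scaleC norm_power norm_inverse)
      also have "\<dots> \<le> inverse (cmod \<mu>) ^ n * (C * (cmod \<mu> / 2) ^ n * norm (u - v))"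
        by (intro mult_left_mono C(2)[OF uv]) simp
      also have "\<dots> = (C * (1/2) ^ n) * norm (u - v)"
        using \<mu> by (simp add: power_divide field_simps)
      also have "\<dots> \<le> 1/2 * norm (u - v)"
        using n C(1) by (intro mult_right_mono) (simp_all add: field_simps)
      finally show "dist ((F ^^ n) u) ((F ^^ n) v) \<le> 1/2 * dist u v"
        by (simp add: dist_norm)
    qed
    then obtain x where x: "x \<in> Y" "(F ^^ n) x = x"
        and uniq: "\<And>z. z \<in> Y \<Longrightarrow> (F ^^ n) z = z \<Longrightarrow> z = x"
      by blast
    have fix_iff: "F z = z \<longleftrightarrow> z = x" if "z \<in> Y" for z
    proof
      assume "F z = z"
      hence "(F ^^ n) z = z" by (induction n) simp_all
      thus "z = x" using uniq that by blast
    next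
      assume "z = x"
      \<comment> \<open>\<open>F x\<close> is again a fixed point of the iterate, so uniqueness
        makes \<open>x\<close> a fixed point of \<open>F\<close> itself.\<close>
      have "(F ^^ n) (F x) = F x"
        using x(2) by (simp flip: funpow_swap1)
      hence "F x = x" using uniq F_in x(1) by blast
      thus "F z = z" using \<open>z = x\<close> by simp
    qed
    have "F z = z \<longleftrightarrow> S z - \<mu> *\<^sub>C z = y" for z
    proof -
      have "F z = z \<longleftrightarrow> \<mu> *\<^sub>C F z = \<mu> *\<^sub>C z"
        using \<mu> by simp
      also have "\<mu> *\<^sub>C F z = S z - y"
        using \<mu> by (simp add: F_def scaleC_scaleC)
      also have "S z - y = \<mu> *\<^sub>C z \<longleftrightarrow> S z - \<mu> *\<^sub>C z = y"
        by (auto simp: algebra_simps)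
      finally show ?thesis .
    qed
    thus ?thesis using fix_iff x(1) by metis
  qed
  moreover have "S x - \<mu> *\<^sub>C x \<in> Y" if "x \<in> Y" for x
    using that Y(3) by (intro complex_vector.subspace_diff complex_vector.subspace_scale Y(1)) auto
  ultimately show ?thesis
    unfolding bij_betw_def inj_on_def by (auto; blast)
qed


subsection \<open>Ascent and descent\<close>

lemma asc_on_finite_iff:
  "asc_on Y S < \<infinity> \<longleftrightarrow> (\<exists>n. kernel_on Y (S ^^ n) = kernel_on Y (S ^^ Suc n))"
proof
  assume "asc_on Y S < \<infinity>"
  hence "{enat n | n. kernel_on Y (S ^^ n) = kernel_on Y (S ^^ Suc n)} \<noteq> {}"
    unfolding asc_on_def by (metis Inf_empty less_irrefl top_enat_def)
  thus "\<exists>n. kernel_on Y (S ^^ n) = kernel_on Y (S ^^ Suc n)" by blast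
next
  assume "\<exists>n. kernel_on Y (S ^^ n) = kernel_on Y (S ^^ Suc n)"
  then obtain n where "asc_on Y S \<le> enat n"
    unfolding asc_on_def by (metis (mono_tags, lifting) Inf_lower mem_Collect_eq)
  thus "asc_on Y S < \<infinity>" using enat_ord_simps(4) order_le_less_trans by blast
qed

lemma dsc_on_finite_iff:
  "dsc_on Y S < \<infinity> \<longleftrightarrow> (\<exists>n. (S ^^ n) ` Y = (S ^^ Suc n) ` Y)"
proof
  assume "dsc_on Y S < \<infinity>"
  hence "{enat n | n. (S ^^ n) ` Y = (S ^^ Suc n) ` Y} \<noteq> {}"
    unfolding dsc_on_def by (metis Inf_empty less_irrefl top_enat_def)
  thus "\<exists>n. (S ^^ n) ` Y = (S ^^ Suc n) ` Y" by blast
next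
  assume "\<exists>n. (S ^^ n) ` Y = (S ^^ Suc n) ` Y"
  then obtain n where "dsc_on Y S \<le> enat n"
    unfolding dsc_on_def by (metis (mono_tags, lifting) Inf_lower mem_Collect_eq)
  thus "dsc_on Y S < \<infinity>" using enat_ord_simps(4) order_le_less_trans by blast
qed

text \<open>The vector \<open>(S ^^ j) x\<close> moves from the kernel of \<open>S ^^ Suc n\<close>
  to that of \<open>S ^^ n\<close>, which lowers the total exponent by one; induction on
  \<open>j\<close> does the rest.\<close>

lemma kernel_on_stable:
  assumes "S ` M \<subseteq> M" "kernel_on M (S ^^ n) = kernel_on M (S ^^ Suc n)"
    and "x \<in> M" "(S ^^ (n + j)) x = 0"
  shows "(S ^^ n) x = 0"
  using assms(4)
proof (induction j)
  case (Suc j)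
  have "(S ^^ j) x \<in> kernel_on M (S ^^ Suc n)"
    using Suc.prems funpow_in[OF assms(1,3), of j]
    by (simp add: kernel_on_def funpow_add[of n j] del: funpow.simps)
      (simp add: funpow_add)
  hence "(S ^^ (n + j)) x = 0"
    unfolding assms(2)[symmetric] by (simp add: kernel_on_def funpow_add)
  thus ?case by (rule Suc.IH)
qed simp

lemma image_stable:
  fixes S :: "'a \<Rightarrow> 'a"
  assumes "(S ^^ n) ` M = (S ^^ Suc n) ` M"
  shows "(S ^^ (n + j)) ` M = (S ^^ n) ` M"
proof (induction j)
  case (Suc j)
  have "(S ^^ (n + Suc j)) ` M = S ` (S ^^ (n + j)) ` M"
    by (simp add: image_comp)
  also have "\<dots> = (S ^^ Suc n) ` M"
    unfolding Suc by (simp add: image_comp)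
  finally show ?case using assms by simp
qed simp

section \<open>Restriction to a summand, and Browder operators\<close>

lemma funpow_cong_on:
  assumes "\<And>x. x \<in> M \<Longrightarrow> A x = S x" "A ` M \<subseteq> M" "x \<in> M"
  shows "(A ^^ n) x = (S ^^ n) x"
proof (induction n)
  case (Suc n)
  have "(A ^^ Suc n) x = S ((A ^^ n) x)"
    using assms(1) funpow_in[OF assms(2,3)] by simp
  thus ?case using Suc by simp
qed simp

text \<open>Kernels and ranges of powers on the summand are the intersections of the summand with
  those on the whole space, so equality of consecutive ones is inherited. The separate
  \<open>S\<close> allows \<open>A = T + P\<close>, which agrees with \<open>T\<close> where
  \<open>P\<close> vanishes.\<close>

lemma asc_dsc_on_summand:
  assumes A: "bounded_clinear A" and P: "bounded_clinear P" "\<And>x. P (P x) = P x"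
    and comm: "\<And>x. P (A x) = A (P x)" and S: "\<And>x. P x = 0 \<Longrightarrow> A x = S x"
    and Browder: "Browder_on UNIV A"
  shows "asc_on {x. P x = 0} S < \<infinity>" "dsc_on {x. P x = 0} S < \<infinity>"
proof -
  let ?M = "{x. P x = 0}"
  have inv: "A ` ?M \<subseteq> ?M" by (auto simp: comm bounded_clinear_zero[OF A])
  have pow: "(A ^^ n) x = (S ^^ n) x" if "x \<in> ?M" for n x
    by (rule funpow_cong_on[OF _ inv that]) (use S in simp)
  have P_pow: "P ((A ^^ n) x) = (A ^^ n) (P x)" for n x
    by (induction n) (simp_all add: comm)
  have "asc_on UNIV A < \<infinity>" "dsc_on UNIV A < \<infinity>"
    using Browder by (simp_all add: Browder_on_def upper_semi_Browder_on_def lower_semi_Browder_on_def)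
  then obtain n m where n: "kernel_on UNIV (A ^^ n) = kernel_on UNIV (A ^^ Suc n)"
    and m: "range (A ^^ m) = range (A ^^ Suc m)"
    unfolding asc_on_finite_iff dsc_on_finite_iff by blast
  have "kernel_on ?M (S ^^ k) = ?M \<inter> kernel_on UNIV (A ^^ k)" for k
    using pow[of _ k] by (auto simp: kernel_on_def)
  thus "asc_on ?M S < \<infinity>"
    unfolding asc_on_finite_iff using n by metis
  have im: "(S ^^ k) ` ?M = ?M \<inter> range (A ^^ k)" for k
  proof -
    have "(S ^^ k) ` ?M = (A ^^ k) ` ?M" using pow by (intro image_cong) auto
    also have "\<dots> = ?M \<inter> range (A ^^ k)"
    proof
      show "(A ^^ k) ` ?M \<subseteq> ?M \<inter> range (A ^^ k)" using funpow_in[OF inv] by blast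
      show "?M \<inter> range (A ^^ k) \<subseteq> (A ^^ k) ` ?M"
      proof
        fix y assume "y \<in> ?M \<inter> range (A ^^ k)"
        then obtain x where x: "P y = 0" "y = (A ^^ k) x" by blast
        note Ak = bounded_clinear_funpow[OF A, of k]
        \<comment> \<open>Passing from \<open>x\<close> to \<open>x - P x\<close> puts the preimage
          into \<open>?M\<close> and changes the image by \<open>P y = 0\<close>.\<close>
        have "(A ^^ k) (x - P x) = y"
          using x P_pow[of k x] by (simp add: bounded_clinear_diff[OF Ak])
        moreover have "x - P x \<in> ?M" by (simp add: bounded_clinear_diff[OF P(1)] P(2))
        ultimately show "y \<in> (A ^^ k) ` ?M" by blast
      qed
    qed
    finally show ?thesis .
  qed
  show "dsc_on ?M S < \<infinity>"
    unfolding dsc_on_finite_iff im using m by metis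
qed

text \<open>With trivial kernel and full range, the exponent 0 already witnesses finite ascent and
  descent.\<close>

lemma bij_betw_imp_Browder_on:
  assumes S: "bounded_clinear S" and M: "complex_vector.subspace M" "closed M"
    and bij: "bij_betw S M M"
  shows "Browder_on M S"
proof -
  have im: "S ` M = M" using bij by (rule bij_betw_imp_surj_on)
  have zero: "0 \<in> M" by (rule complex_vector.subspace_0[OF M(1)])
  have ker: "kernel_on M S = {0}"
    using bij zero bounded_clinear_zero[OF S] by (auto simp: kernel_on_def bij_betw_def inj_on_def)
  have "finite_dim (kernel_on M S)"
    unfolding finite_dim_def ker by (intro exI[of _ "{}"]) simp
  moreover have "finite_codim_in M (S ` M)"
    unfolding finite_codim_in_def im
    by (intro exI[of _ "{}"]) (simp add: complex_vector.span_eq_iff[THEN iffD2, OF M(1)])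
  moreover have "asc_on M S < \<infinity>"
    unfolding asc_on_finite_iff
    by (rule exI[of _ 0]) (use ker zero in \<open>auto simp: kernel_on_def\<close>)
  moreover have "dsc_on M S < \<infinity>"
    unfolding dsc_on_finite_iff by (rule exI[of _ 0]) (simp add: im)
  ultimately show ?thesis
    using im M(2) by (simp add: Browder_on_def upper_semi_Browder_on_def lower_semi_Browder_on_def
        upper_semi_Fredholm_on_def lower_semi_Fredholm_on_def)
qed

section \<open>Splitting off the nilpotent part\<close>

text \<open>By the open mapping theorem for \<open>E x + y\<close> with \<open>y\<close> in
  \<open>V\<close>, the \<open>V\<close> component of a vector is bounded by a multiple of its norm.
  For a limit of range vectors this component is thus arbitrarily small, hence 0.\<close>

lemma closed_range_complemented:
  fixes E :: "'a::banach \<Rightarrow> 'a"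
  assumes E: "bounded_linear E" and V: "subspace V" "closed V"
    and int: "range E \<inter> V = {0}" and sum: "\<And>x. \<exists>y. x - E y \<in> V"
  shows "closed (range E)"
proof -
  interpret E: bounded_linear E by fact
  let ?f = "\<lambda>z. E (fst z) + snd z"
  have f: "bounded_linear ?f"
    by (intro bounded_linear_add bounded_linear_compose[OF E] bounded_linear_fst bounded_linear_snd)
  have im: "?f ` (UNIV \<times> V) = UNIV"
  proof -
    have "x \<in> ?f ` (UNIV \<times> V)" for x
    proof -
      obtain y where "x - E y \<in> V" using sum by blast
      thus ?thesis by (intro image_eqI[of _ _ "(y, x - E y)"]) auto
    qed
    thus ?thesis by blast
  qed
  have dom: "subspace (UNIV \<times> V)" "closed (UNIV \<times> V)"
    by (intro subspace_Times subspace_UNIV V, intro closed_Times closed_UNIV V)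
  have "closed (?f ` (UNIV \<times> V))" unfolding im by simp
  from open_mapping[OF f dom this] obtain K where
    K: "K > 0" "\<And>z. z \<in> UNIV \<Longrightarrow> \<exists>a\<in>UNIV \<times> V. ?f a = z \<and> norm a \<le> K * norm z"
    unfolding im by blast
  show ?thesis
    unfolding closed_sequential_limits
  proof (intro allI impI, elim conjE)
    fix z l assume z: "\<forall>n. z n \<in> range E" and lim: "z \<longlonglongrightarrow> l"
    obtain a where a: "l - E a \<in> V" using sum by blast
    \<comment> \<open>Since \<open>z n\<close> lies in the range, \<open>z n - l\<close> and
      \<open>l\<close> have opposite \<open>V\<close> components, and \<open>l - E a\<close> is that
      of \<open>l\<close>.\<close>
    have "norm (l - E a) \<le> K * norm (z n - l)" for n
    proof -
      obtain x y where xy: "y \<in> V" "E x + y = z n - l" "norm (x, y) \<le> K * norm (z n - l)"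
        using K(2)[of "z n - l"] by auto
      obtain w where w: "z n = E w" using z by blast
      have "E (w - a - x) = y + (l - E a)"
        using xy(2) w by (simp add: E.diff E.add algebra_simps)
      moreover have "y + (l - E a) \<in> V" by (rule subspace_add[OF V(1) xy(1) a])
      ultimately have "y + (l - E a) \<in> range E \<inter> V" by (metis IntI rangeI)
      hence "l - E a = - y" unfolding int by (simp add: eq_neg_iff_add_eq_0 add.commute)
      thus ?thesis using norm_snd_le[of y x] xy(3) by simp
    qed
    moreover have "(\<lambda>n. K * norm (z n - l)) \<longlonglongrightarrow> 0"
      using tendsto_mult_right_zero[OF tendsto_norm_zero[OF LIM_zero[OF lim]]] .
    ultimately have "norm (l - E a) \<le> 0"
      by (intro LIMSEQ_le_const) auto
    thus "l \<in> range E" by auto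
  qed
qed

text \<open>If \<open>T\<close> has finite ascent and descent on \<open>M\<close>, the nilpotent part of \<open>T\<close> on \<open>M\<close> is
  absorbed into \<open>N\<close>. The new pair consists of the range and the kernel of \<open>T ^^ k\<close> composed
  with the projection onto \<open>M\<close>, for \<open>k\<close> large.\<close>

lemma Red_bij_quasinilpotent:
  assumes T: "bounded_clinear T" and MN: "(M, N) \<in> Red T" and qn: "quasinilpotent_on N T"
    and asc: "asc_on M T < \<infinity>" and dsc: "dsc_on M T < \<infinity>"
  shows "\<exists>(M, N) \<in> Red T. bij_betw T M M \<and> quasinilpotent_on N T"
proof -
  from T MN obtain P where P: "bounded_clinear P" "\<And>x. P (P x) = P x" "\<And>x. P (T x) = T (P x)"
    and M: "M = {x. P x = 0}" and N: "N = {x. P x = x}"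
    and M_inv: "T ` M \<subseteq> M"
    by (rule RedE) blast
  obtain n m where n: "kernel_on M (T ^^ n) = kernel_on M (T ^^ Suc n)"
    and m: "(T ^^ m) ` M = (T ^^ Suc m) ` M"
    using asc dsc unfolding asc_on_finite_iff dsc_on_finite_iff by blast
  \<comment> \<open>At least both stabilisation indices, so kernels and images are stationary from
    \<open>k\<close> on.\<close>
  define k where "k = n + m"
  have ker: "(T ^^ k) x = 0" if "x \<in> M" "(T ^^ (k + j)) x = 0" for x j
  proof -
    have "(T ^^ n) x = 0"
      using kernel_on_stable[OF M_inv n that(1), of "m + j"] that(2) by (simp add: k_def add.assoc)
    thus ?thesis by (rule funpow_kernel_mono[OF T, rotated]) (simp add: k_def)
  qed
  have im: "(T ^^ (k + j)) ` M = (T ^^ k) ` M" for j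
  proof -
    have "(T ^^ (k + j)) ` M = (T ^^ m) ` M"
      using image_stable[OF m, of "n + j"] by (simp add: k_def add_ac)
    also have "\<dots> = (T ^^ k) ` M"
      using image_stable[OF m, of n] by (simp add: k_def add_ac)
    finally show ?thesis .
  qed
  have Tk: "bounded_clinear (T ^^ k)" by (rule bounded_clinear_funpow[OF T])
  define E where "E = (\<lambda>x. (T ^^ k) (x - P x))"
  have E: "bounded_clinear E"
    unfolding E_def
    by (rule bounded_clinear_compose[OF Tk bounded_clinear_sub[OF bounded_clinear_ident P(1)]])
  have E_T: "E (T x) = T (E x)" for x
    by (simp add: E_def P(3) funpow_swap1 flip: bounded_clinear_diff[OF T])
  have proj_M: "x - P x \<in> M" for x by (simp add: M bounded_clinear_diff[OF P(1)] P(2))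
  have E_M: "E x = (T ^^ k) x" if "x \<in> M" for x using that by (simp add: E_def M)
  have range_E: "range E = (T ^^ k) ` M"
  proof
    show "range E \<subseteq> (T ^^ k) ` M" unfolding E_def using proj_M by blast
    show "(T ^^ k) ` M \<subseteq> range E" using E_M by (metis image_subsetI rangeI)
  qed
  have range_M: "(T ^^ k) ` M \<subseteq> M" using funpow_in[OF M_inv] by blast
  define V where "V = {x. E x = 0}"
  have V: "complex_vector.subspace V" "closed V" "T ` V \<subseteq> V"
    unfolding V_def using complex_subspace_kernel[OF E] closed_kernel[OF E]
    by (auto simp: E_T bounded_clinear_zero[OF T])
  \<comment> \<open>This is finite ascent: if \<open>y = (T ^^ k) u\<close> is killed by
    \<open>T ^^ k\<close>, then \<open>(T ^^ (k + k)) u = 0\<close>, which forces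
    \<open>y = 0\<close>.\<close>
  have int: "range E \<inter> V = {0}"
  proof
    show "range E \<inter> V \<subseteq> {0}"
    proof
      fix y assume y: "y \<in> range E \<inter> V"
      then obtain u where u: "u \<in> M" "y = (T ^^ k) u" unfolding range_E by blast
      hence "y \<in> M" using range_M by blast
      hence "(T ^^ k) y = 0" using y E_M by (simp add: V_def)
      hence "(T ^^ (k + k)) u = 0" using u by (simp add: funpow_add)
      thus "y \<in> {0}" using ker[OF u(1)] u(2) by simp
    qed
    show "{0} \<subseteq> range E \<inter> V"
      using bounded_clinear_zero[OF E] by (auto simp: V_def intro: image_eqI[of _ _ 0])
  qed
  \<comment> \<open>This is finite descent: \<open>E x\<close> lies in the image of
    \<open>T ^^ (k + k)\<close>, so \<open>E x = E (E v)\<close> for a suitable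
    \<open>v\<close>.\<close>
  have sum: "\<exists>y. x - E y \<in> V" for x
  proof -
    have "E x \<in> (T ^^ (k + k)) ` M" unfolding im range_E[symmetric] by blast
    then obtain v where v: "v \<in> M" "E x = (T ^^ k) ((T ^^ k) v)" by (auto simp: funpow_add)
    have "(T ^^ k) v \<in> M" using v(1) range_M by blast
    hence "E (E v) = E x" using v by (simp add: E_M)
    hence "x - E v \<in> V" by (simp add: V_def bounded_clinear_diff[OF E])
    thus ?thesis by blast
  qed
  have E_sub: "complex_vector.subspace (range E)"
    by (rule complex_subspace_image[OF E complex_vector.subspace_UNIV])
  have "closed (range E)"
    by (rule closed_range_complemented[OF bounded_clinear_bounded_linear[OF E]
          subspace_of_complex[OF V(1)] V(2) int sum])
  moreover have T_E: "T ` range E = range E"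
  proof -
    have "T ` range E = (T ^^ (k + 1)) ` M" unfolding range_E by (simp add: image_comp)
    thus ?thesis unfolding im range_E .
  qed
  moreover have "{r + v | r v. r \<in> range E \<and> v \<in> V} = UNIV"
  proof (rule UNIV_eq_I[symmetric])
    fix x
    obtain y where "x - E y \<in> V" using sum by blast
    moreover have "x = E y + (x - E y)" by simp
    ultimately show "x \<in> {r + v | r v. r \<in> range E \<and> v \<in> V}" by blast
  qed
  ultimately have "(range E, V) \<in> Red T"
    using E_sub V int by (simp add: Red_def)
  moreover have "bij_betw T (range E) (range E)"
  proof (rule bij_betw_linearI[OF T E_sub T_E])
    fix y assume y: "y \<in> range E" "T y = 0"
    then obtain u where u: "u \<in> M" "y = (T ^^ k) u" unfolding range_E by blast
    thus "y = 0" using ker[OF u(1), of 1] y(2) by simp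
  qed
  moreover have "quasinilpotent_on V T"
  proof (rule quasinilpotent_onI[OF T complex_vector.subspace_0[OF V(1)]])
    fix e :: real assume e: "e > 0"
    have "0 \<in> N" by (simp add: N bounded_clinear_zero[OF P(1)])
    then obtain C where C: "C > 0" "\<And>j x. x \<in> N \<Longrightarrow> norm ((T ^^ j) x) \<le> C * e ^ j * norm x"
      using quasinilpotent_onD[OF qn T _ e] by metis
    obtain K where K: "K > 0" "\<And>x. norm (P x) \<le> norm x * K"
      using bounded_linear.pos_bounded[OF bounded_clinear_bounded_linear[OF P(1)]] by blast
    have "norm ((T ^^ j) x) \<le> (C * K) * e ^ j * norm x" if "j \<ge> k" "x \<in> V" for j x
    proof -
      note Tj = bounded_clinear_funpow[OF T, of j]
      \<comment> \<open>On \<open>V\<close> the powers from \<open>k\<close> on annihilate the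
        \<open>M\<close> component, so only the quasinilpotent \<open>N\<close> component
        contributes.\<close>
      have "(T ^^ j) (x - P x) = 0"
        by (rule funpow_kernel_mono[OF T that(1)]) (use that(2) in \<open>simp add: V_def E_def\<close>)
      hence "(T ^^ j) x = (T ^^ j) (P x)" by (simp add: bounded_clinear_diff[OF Tj])
      hence "norm ((T ^^ j) x) \<le> C * e ^ j * norm (P x)"
        using C(2)[of "P x" j] P(2) by (simp add: N)
      also have "\<dots> \<le> C * e ^ j * (norm x * K)"
        using C(1) e by (intro mult_left_mono K) simp
      finally show ?thesis by (simp add: mult_ac)
    qed
    thus "\<exists>C J. \<forall>j\<ge>J. \<forall>x\<in>V. norm ((T ^^ j) x) \<le> C * e ^ j * norm x"
      by (intro exI[of _ "C * K"] exI[of _ k]) simp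
  qed
  ultimately show ?thesis by blast
qed


subsection \<open>Kato operators\<close>

text \<open>The vector \<open>w k\<close> is the power series \<open>\<Sum>j. \<mu> ^ j *\<^sub>C u (j + k)\<close>. In particular
  \<open>S (w 1) - \<mu> *\<^sub>C w 1 = u 0\<close>, and \<open>w 0\<close> is an eigenvector if \<open>S (u 0) = 0\<close>.\<close>

lemma backward_orbit_shift:
  fixes S :: "'a::complex_banach \<Rightarrow> 'a"
  assumes S: "bounded_clinear S" and M: "complex_vector.subspace M" "closed M"
    and u: "\<And>k. u k \<in> M" "\<And>k. S (u (Suc k)) = u k" "\<And>k. norm (u k) \<le> A * K ^ k"
    and K: "K > 0" "cmod \<mu> * K \<le> 1/2"
  obtains w where "\<And>k. w k \<in> M" "\<And>k. S (w (Suc k)) = w k"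
    "\<And>k. norm (w k) \<le> 2 * A * K ^ k" "\<And>k. w k = u k + \<mu> *\<^sub>C w (Suc k)"
proof -
  have A: "A \<ge> 0" using u(3)[of 0] norm_ge_zero[of "u 0"] by (simp del: norm_ge_zero)
  define f where "f k j = \<mu> ^ j *\<^sub>C u (j + k)" for k j
  define w where "w k = suminf (f k)" for k
  have f_le: "norm (f k j) \<le> A * K ^ k * (1/2) ^ j" for k j
  proof -
    have "norm (f k j) \<le> cmod \<mu> ^ j * (A * K ^ (j + k))"
      unfolding f_def norm_scaleC norm_power by (intro mult_left_mono u) simp
    also have "\<dots> = A * K ^ k * (cmod \<mu> * K) ^ j"
      by (simp add: power_add power_mult_distrib)
    also have "\<dots> \<le> A * K ^ k * (1/2) ^ j"
      using K A by (intro mult_left_mono power_mono) simp_all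
    finally show ?thesis .
  qed
  have sums: "(\<lambda>j. A * K ^ k * (1/2) ^ j) sums (2 * A * K ^ k)" for k
    using sums_mult[OF geometric_sums[of "1/2::real"], of "A * K ^ k"] by (simp add: mult_ac)
  have summ_norm: "summable (\<lambda>j. norm (f k j))" for k
    by (rule summable_comparison_test'[OF sums_summable[OF sums], of 0]) (use f_le in simp)
  have summ: "summable (f k)" for k by (rule summable_norm_cancel[OF summ_norm])
  show ?thesis
  proof
    fix k
    show "w k \<in> M"
    proof (rule closed_sequentially[OF M(2)])
      show "(\<lambda>n. \<Sum>j<n. f k j) \<longlonglongrightarrow> w k"
        using summable_LIMSEQ[OF summ] by (simp add: w_def)
      show "(\<Sum>j<n. f k j) \<in> M" for n
        unfolding f_def
        by (intro complex_vector.subspace_sum complex_vector.subspace_scale M u)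
    qed
    have "S (w (Suc k)) = (\<Sum>j. S (f (Suc k) j))"
      unfolding w_def by (rule bounded_linear.suminf[OF bounded_clinear_bounded_linear[OF S] summ])
    also have "\<dots> = w k"
      by (simp add: w_def f_def[abs_def] bounded_clinear_scaleC[OF S] u(2))
    finally show "S (w (Suc k)) = w k" .
    have "norm (w k) \<le> (\<Sum>j. norm (f k j))"
      unfolding w_def by (rule summable_norm[OF summ_norm])
    also have "\<dots> \<le> 2 * A * K ^ k"
      using suminf_le[OF f_le summ_norm sums_summable[OF sums]] sums_unique[OF sums] by simp
    finally show "norm (w k) \<le> 2 * A * K ^ k" .
    have "w k = f k 0 + (\<Sum>j. f k (Suc j))"
      unfolding w_def using suminf_split_head[OF summ] by simp
    also have "(\<Sum>j. f k (Suc j)) = (\<Sum>j. \<mu> *\<^sub>C f (Suc k) j)"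
      by (simp add: f_def scaleC_scaleC)
    also have "\<dots> = \<mu> *\<^sub>C w (Suc k)"
      unfolding w_def by (rule bounded_linear.suminf[OF bounded_linear_scaleC summ, symmetric])
    finally show "w k = u k + \<mu> *\<^sub>C w (Suc k)" by (simp add: f_def)
  qed
qed

text \<open>The Kato condition makes \<open>S\<close> map the intersection \<open>R\<close> of the
  ranges of its powers onto itself, with preimages of controlled norm. Iterating a choice
  \<open>g\<close> of such preimages, starting from a kernel vector, gives the orbit.\<close>

lemma Kato_backward_orbit:
  assumes S: "bounded_clinear S" and M: "complex_vector.subspace M" "closed M" "S ` M \<subseteq> M"
    and Kato: "Kato_on M S"
  obtains K where "K > 0" "\<And>x. x \<in> M \<Longrightarrow> S x = 0 \<Longrightarrow>
    \<exists>u. u 0 = x \<and> (\<forall>k. u k \<in> M \<and> S (u (Suc k)) = u k \<and> norm (u k) \<le> norm x * K ^ k)"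
proof -
  have cl: "closed (S ` M)" and ker: "\<And>x n. x \<in> M \<Longrightarrow> S x = 0 \<Longrightarrow> x \<in> (S ^^ n) ` M"
    using Kato by (auto simp: Kato_on_def kernel_on_def)
  obtain K where K: "K > 0" "\<And>z. z \<in> S ` M \<Longrightarrow> \<exists>a\<in>M. S a = z \<and> norm a \<le> K * norm z"
    using open_mapping[OF bounded_clinear_bounded_linear[OF S] subspace_of_complex[OF M(1)] M(2) cl]
    by blast
  define R where "R = (\<Inter>n. (S ^^ n) ` M)"
  have "\<exists>y. y \<in> R \<and> S y = z \<and> norm y \<le> K * norm z" if z: "z \<in> R" for z
  proof -
    have "z \<in> (S ^^ 1) ` M" using z unfolding R_def by blast
    then obtain y where y: "y \<in> M" "S y = z" "norm y \<le> K * norm z"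
      using K(2)[of z] by auto
    \<comment> \<open>Two preimages of \<open>z\<close> differ by a kernel vector, which lies in the
      range of every power; so \<open>y\<close> inherits membership from the preimage
      \<open>(S ^^ n) v\<close>.\<close>
    have "y \<in> (S ^^ n) ` M" for n
    proof -
      have sub: "complex_vector.subspace ((S ^^ n) ` M)"
        by (intro complex_subspace_image bounded_clinear_funpow S M)
      have "z \<in> (S ^^ Suc n) ` M" using z unfolding R_def by blast
      then obtain v where v: "v \<in> M" "z = S ((S ^^ n) v)" by auto
      have SvM: "(S ^^ n) v \<in> M" by (rule funpow_in[OF M(3) v(1)])
      have "S (y - (S ^^ n) v) = 0"
        using y v by (simp add: bounded_clinear_diff[OF S])
      hence "y - (S ^^ n) v \<in> (S ^^ n) ` M"
        by (intro ker complex_vector.subspace_diff M(1) y SvM)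
      from complex_vector.subspace_add[OF sub this imageI[OF v(1)]]
      show ?thesis by simp
    qed
    thus ?thesis using y by (auto simp: R_def)
  qed
  then obtain g where g: "\<And>z. z \<in> R \<Longrightarrow> g z \<in> R" "\<And>z. z \<in> R \<Longrightarrow> S (g z) = z"
      "\<And>z. z \<in> R \<Longrightarrow> norm (g z) \<le> K * norm z"
    by metis
  show ?thesis
  proof (rule that[OF K(1)])
    fix x assume x: "x \<in> M" "S x = 0"
    define u where "u k = (g ^^ k) x" for k
    have uR: "u k \<in> R" for k
      by (induction k) (use ker[OF x] g in \<open>auto simp: u_def R_def\<close>)
    have "R \<subseteq> (S ^^ 0) ` M" unfolding R_def by blast
    hence "u k \<in> M" for k using uR by auto
    moreover have "S (u (Suc k)) = u k" for k
      using g(2)[OF uR[of k]] by (simp add: u_def)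
    moreover have "norm (u k) \<le> norm x * K ^ k" for k
    proof (induction k)
      case (Suc k)
      have "norm (u (Suc k)) \<le> K * norm (u k)"
        using g(3)[OF uR[of k]] by (simp add: u_def)
      also have "\<dots> \<le> K * (norm x * K ^ k)"
        using Suc K(1) by (intro mult_left_mono) auto
      finally show ?case by (simp add: mult_ac)
    qed (simp add: u_def)
    ultimately show "\<exists>u. u 0 = x \<and>
        (\<forall>k. u k \<in> M \<and> S (u (Suc k)) = u k \<and> norm (u k) \<le> norm x * K ^ k)"
      by (intro exI[of _ u]) (simp add: u_def)
  qed
qed

text \<open>An operator of finite ascent that is surjective on a subspace is injective there.
  Applied to \<open>A\<close> on the analytic core, this makes the eigenvector \<open>w 0\<close>
  vanish, although it differs from \<open>x\<close> by at most half the norm of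
  \<open>x\<close>.\<close>

lemma Kato_inj:
  assumes S: "bounded_clinear S" and M: "complex_vector.subspace M" "closed M" "S ` M \<subseteq> M"
    and Kato: "Kato_on M S"
    and asc: "\<And>e. e > 0 \<Longrightarrow> \<exists>\<mu>. cmod \<mu> < e \<and> asc_on M (\<lambda>x. S x - \<mu> *\<^sub>C x) < \<infinity>"
    and x: "x \<in> M" "S x = 0"
  shows "x = 0"
proof -
  obtain K where K: "K > 0" and orbit: "\<And>x. x \<in> M \<Longrightarrow> S x = 0 \<Longrightarrow>
      \<exists>u. u 0 = x \<and> (\<forall>k. u k \<in> M \<and> S (u (Suc k)) = u k \<and> norm (u k) \<le> norm x * K ^ k)"
    using Kato_backward_orbit[OF S M Kato] by blast
  \<comment> \<open>The power series bound only asks for \<open>cmod \<mu> * K \<le> 1/2\<close>;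
    the smaller value 1/4 turns the final estimate into
    \<open>norm x \<le> norm x / 2\<close>.\<close>
  obtain \<mu> where "cmod \<mu> < 1 / (4 * K)" and "asc_on M (\<lambda>x. S x - \<mu> *\<^sub>C x) < \<infinity>"
    using asc[of "1 / (4 * K)"] K by auto
  hence \<mu>: "cmod \<mu> * K < 1/4" using K by (simp add: field_simps)
  define A where "A = (\<lambda>x. S x - \<mu> *\<^sub>C x)"
  obtain n where n: "kernel_on M (A ^^ n) = kernel_on M (A ^^ Suc n)"
    using \<open>asc_on M _ < \<infinity>\<close> unfolding A_def[symmetric] asc_on_finite_iff by blast
  \<comment> \<open>the analytic core of the restriction of \<open>S\<close> to \<open>M\<close>, on which \<open>A\<close> is surjective\<close>
  define Q where "Q y \<longleftrightarrow> (\<exists>u a. u (0::nat) = y \<and>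
    (\<forall>k. u k \<in> M \<and> S (u (Suc k)) = u k \<and> norm (u k) \<le> a * K ^ k))" for y
  have step: "\<exists>z. Q z \<and> A z = y" if "Q y" for y
  proof -
    from that obtain u a where "u 0 = y \<and>
        (\<forall>k. u k \<in> M \<and> S (u (Suc k)) = u k \<and> norm (u k) \<le> a * K ^ k)"
      unfolding Q_def by (elim exE) (rule that)
    hence u: "u 0 = y" "\<And>k. u k \<in> M" "\<And>k. S (u (Suc k)) = u k"
        "\<And>k. norm (u k) \<le> a * K ^ k"
      by blast+
    have "cmod \<mu> * K \<le> 1/2" using \<mu> by simp
    then obtain w where w: "\<And>k. w k \<in> M" "\<And>k. S (w (Suc k)) = w k"
        "\<And>k. norm (w k) \<le> 2 * a * K ^ k" "\<And>k. w k = u k + \<mu> *\<^sub>C w (Suc k)"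
      using backward_orbit_shift[where u = u and A = a, OF S M(1,2) u(2,3,4) K] by blast
    have "norm (w (Suc k)) \<le> (2 * a * K) * K ^ k" for k
      using w(3)[of "Suc k"] by (simp add: mult_ac)
    \<comment> \<open>The orbit of \<open>w 1\<close> is the tail of \<open>w\<close>; the shift of
      index costs a factor \<open>K\<close> in the constant.\<close>
    hence "Q (w (Suc 0))"
      unfolding Q_def using w(1,2)
      by (intro exI[of _ "\<lambda>k. w (Suc k)"] exI[of _ "2 * a * K"]) auto
    moreover have "A (w (Suc 0)) = y"
      using w(2)[of 0] w(4)[of 0] u(1) by (simp add: A_def)
    ultimately show ?thesis by blast
  qed
  have steps: "\<exists>z. Q z \<and> (A ^^ k) z = y" if "Q y" for k y
  proof (induction k)
    case 0
    show ?case using that by auto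
  next
    case (Suc k)
    then obtain z where "Q z" "(A ^^ k) z = y" by blast
    moreover obtain z' where "Q z'" "A z' = z" using step[OF \<open>Q z\<close>] by blast
    ultimately show ?case by (intro exI[of _ z']) (simp add: funpow_swap1)
  qed
  obtain u where u: "u 0 = x" "\<And>k. u k \<in> M" "\<And>k. S (u (Suc k)) = u k"
      "\<And>k. norm (u k) \<le> norm x * K ^ k"
    using orbit[OF x] by blast
  have "cmod \<mu> * K \<le> 1/2" using \<mu> by simp
  then obtain w where w: "\<And>k. w k \<in> M" "\<And>k. S (w (Suc k)) = w k"
      "\<And>k. norm (w k) \<le> 2 * norm x * K ^ k" "\<And>k. w k = u k + \<mu> *\<^sub>C w (Suc k)"
    using backward_orbit_shift[where u = u and A = "norm x", OF S M(1,2) u(2,3,4) K] by blast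
  have "S (w 0) = S (u 0) + \<mu> *\<^sub>C S (w (Suc 0))"
    by (subst w(4)) (simp add: bounded_clinear_add[OF S] bounded_clinear_scaleC[OF S])
  hence Aw: "A (w 0) = 0" using x(2) u(1) w(2) by (simp add: A_def)
  have "Q (w 0)"
    unfolding Q_def using w(1,2,3) by (intro exI[of _ w] exI[of _ "2 * norm x"]) auto
  \<comment> \<open>As \<open>A (w 0) = 0\<close>, this \<open>z\<close> lies in the kernel of
    \<open>A ^^ Suc n\<close>, hence in that of \<open>A ^^ n\<close>, so
    \<open>w 0 = 0\<close>.\<close>
  then obtain z where z: "Q z" "(A ^^ n) z = w 0" using steps by blast
  have "z \<in> M" using z(1) unfolding Q_def by blast
  moreover have "(A ^^ Suc n) z = 0" using z Aw by simp
  ultimately have "z \<in> kernel_on M (A ^^ n)" unfolding n by (simp add: kernel_on_def)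
  hence "w 0 = 0" using z(2) by (simp add: kernel_on_def)
  hence "x = - (\<mu> *\<^sub>C w (Suc 0))"
    using w(4)[of 0] u(1) by (simp add: eq_neg_iff_add_eq_0)
  hence "norm x = cmod \<mu> * norm (w (Suc 0))" by (simp add: norm_scaleC)
  also have "\<dots> \<le> cmod \<mu> * (2 * norm x * K)"
    using w(3)[of "Suc 0"] by (intro mult_left_mono) auto
  also have "\<dots> = (cmod \<mu> * K) * (2 * norm x)" by simp
  also have "\<dots> \<le> 1/4 * (2 * norm x)" using \<mu> by (intro mult_right_mono) auto
  finally show "x = 0" by simp
qed

text \<open>Surjectivity is first proved for a nearby \<open>A\<close>, which has finite descent.
  The lower bound for \<open>S\<close> carries over to \<open>A\<close>, so \<open>S\<close> is a
  small enough perturbation of \<open>A\<close>.\<close>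

lemma Kato_bij_betw:
  assumes S: "bounded_clinear S" and M: "complex_vector.subspace M" "closed M" "S ` M \<subseteq> M"
    and Kato: "Kato_on M S"
    and asc_dsc: "\<And>e. e > 0 \<Longrightarrow> \<exists>\<mu>. cmod \<mu> < e \<and>
      asc_on M (\<lambda>x. S x - \<mu> *\<^sub>C x) < \<infinity> \<and> dsc_on M (\<lambda>x. S x - \<mu> *\<^sub>C x) < \<infinity>"
  shows "bij_betw S M M"
proof -
  have inj: "x = 0" if "x \<in> M" "S x = 0" for x
    using Kato_inj[OF S M Kato _ that] asc_dsc by blast
  have cl: "closed (S ` M)" using Kato by (simp add: Kato_on_def)
  obtain K where K: "K > 0" "\<And>z. z \<in> S ` M \<Longrightarrow> \<exists>a\<in>M. S a = z \<and> norm a \<le> K * norm z"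
    using open_mapping[OF bounded_clinear_bounded_linear[OF S] subspace_of_complex[OF M(1)] M(2) cl]
    by blast
  have below: "norm x \<le> K * norm (S x)" if x: "x \<in> M" for x
  proof -
    obtain a where a: "a \<in> M" "S a = S x" "norm a \<le> K * norm (S x)"
      using K(2)[of "S x"] x by blast
    have "a - x = 0"
      using inj[OF complex_vector.subspace_diff[OF M(1) a(1) x]] a(2)
      by (simp add: bounded_clinear_diff[OF S])
    thus ?thesis using a by simp
  qed
  \<comment> \<open>Then \<open>S\<close> is bounded below by \<open>3 * \<delta>\<close> and
    \<open>A\<close> by \<open>2 * \<delta>\<close>, which exceeds \<open>cmod \<mu>\<close> and
    permits adding \<open>\<mu>\<close> back.\<close>
  define \<delta> where "\<delta> = 1 / (3 * K)"
  obtain \<mu> where \<mu>: "cmod \<mu> < \<delta>" and "dsc_on M (\<lambda>x. S x - \<mu> *\<^sub>C x) < \<infinity>"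
    using asc_dsc[of \<delta>] K by (auto simp: \<delta>_def)
  define A where "A = (\<lambda>x. S x - \<mu> *\<^sub>C x)"
  have A: "bounded_clinear A" unfolding A_def by (rule bounded_clinear_shift[OF S])
  obtain n where n: "(A ^^ n) ` M = (A ^^ Suc n) ` M"
    using \<open>dsc_on M _ < \<infinity>\<close> unfolding A_def[symmetric] dsc_on_finite_iff by blast
  have A_M: "A x \<in> M" if "x \<in> M" for x
    unfolding A_def using that M(3)
    by (intro complex_vector.subspace_diff complex_vector.subspace_scale M) auto
  have A_below: "2 * \<delta> * norm x \<le> norm (A x)" if "x \<in> M" for x
  proof -
    have "3 * \<delta> * norm x \<le> norm (S x)"
      using below[OF that] K(1) by (simp add: \<delta>_def field_simps)
    moreover have "norm (S x) \<le> norm (A x) + cmod \<mu> * norm x"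
      using norm_triangle_ineq[of "A x" "\<mu> *\<^sub>C x"] by (simp add: A_def norm_scaleC)
    moreover have "cmod \<mu> * norm x \<le> \<delta> * norm x"
      using \<mu> by (intro mult_right_mono) auto
    ultimately show ?thesis by (simp add: algebra_simps)
  qed
  have \<delta>: "\<delta> > 0" using K by (simp add: \<delta>_def)
  have A_inj: "x = 0" if "x \<in> M" "A x = 0" for x
    using A_below[OF that(1)] that(2) \<delta> by (simp add: mult_le_0_iff)
  have An_inj: "x = 0" if "x \<in> M" "(A ^^ k) x = 0" for x k
    using that(2)
  proof (induction k)
    case (Suc k)
    have "(A ^^ k) x \<in> M" using A_M that(1) by (intro funpow_in) auto
    thus ?case using Suc A_inj by simp
  qed simp
  have "A ` M = M"
  proof
    show "M \<subseteq> A ` M"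
    proof
      fix y assume y: "y \<in> M"
      \<comment> \<open>Finite descent gives \<open>(A ^^ n) y = (A ^^ n) (A v)\<close>, and
        injectivity cancels the power.\<close>
      hence "(A ^^ n) y \<in> (A ^^ Suc n) ` M" using n by blast
      then obtain v where v: "v \<in> M" "(A ^^ n) y = (A ^^ n) (A v)"
        by (auto simp: funpow_swap1)
      have "y - A v = 0"
      proof (rule An_inj)
        show "y - A v \<in> M" by (intro complex_vector.subspace_diff M y A_M v)
        show "(A ^^ n) (y - A v) = 0"
          using v by (simp add: bounded_clinear_diff[OF bounded_clinear_funpow[OF A]])
      qed
      thus "y \<in> A ` M" using v by auto
    qed
  qed (use A_M in blast)
  hence "bij_betw A M M" using A_inj by (intro bij_betw_linearI[OF A M(1)])
  hence "bij_betw (\<lambda>x. A x - (- \<mu>) *\<^sub>C x) M M"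
    using \<mu> \<delta> A_below by (intro bij_betw_shift[OF A M(1,2), of "2 * \<delta>"]) auto
  thus ?thesis by (simp add: A_def)
qed

subsection \<open>Generalized Drazin invertibility\<close>

text \<open>Given \<open>B\<close>, the projection is \<open>P = I - T B\<close>; \<open>B\<close>
  inverts \<open>T\<close> on the kernel of \<open>P\<close>, and \<open>T B T - T = - T P\<close>.
  Conversely, \<open>B\<close> is the inverse of \<open>T\<close> on \<open>M\<close>, extended by 0
  on \<open>N\<close>.\<close>

lemma generalized_Drazin_invertible_iff_Red:
  assumes T: "bounded_clinear T"
  shows "generalized_Drazin_invertible T \<longleftrightarrow>
    (\<exists>(M, N) \<in> Red T. bij_betw T M M \<and> quasinilpotent_on N T)"
proof
  assume "generalized_Drazin_invertible T"
  then obtain B where B: "bounded_clinear B" "\<And>x. T (B x) = B (T x)" "\<And>x. B (T (B x)) = B x"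
    and qn: "quasinilpotent_on UNIV (\<lambda>x. T (B (T x)) - T x)"
    by (auto simp: generalized_Drazin_invertible_def fun_eq_iff)
  define P where "P = (\<lambda>x. x - T (B x))"
  have P: "bounded_clinear P"
    unfolding P_def
    by (rule bounded_clinear_sub[OF bounded_clinear_ident bounded_clinear_compose[OF T B(1)]])
  have PP: "P (P x) = P x" for x
    by (simp add: P_def bounded_clinear_diff[OF T] bounded_clinear_diff[OF B(1)] B(3)
        bounded_clinear_zero[OF T])
  have PT: "P (T x) = T (P x)" for x
    by (simp add: P_def bounded_clinear_diff[OF T] flip: B(2))
  have Red: "({x. P x = 0}, {x. P x = x}) \<in> Red T"
    unfolding Red_iff_projection[OF T]
    by (intro exI[of _ P]) (simp add: P PP PT fun_eq_iff)
  have "bij_betw T {x. P x = 0} {x. P x = 0}"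
  proof (rule bij_betwI[where g = B])
    show "T \<in> {x. P x = 0} \<rightarrow> {x. P x = 0}"
      by (simp add: PT bounded_clinear_zero[OF T])
    have "P (B x) = B (P x)" for x
      by (simp add: P_def bounded_clinear_diff[OF B(1)] B(2))
    thus "B \<in> {x. P x = 0} \<rightarrow> {x. P x = 0}"
      by (simp add: bounded_clinear_zero[OF B(1)])
  qed (simp_all add: P_def flip: B(2))
  moreover have "(\<lambda>x. T (B (T x)) - T x) = (\<lambda>x. (-1) *\<^sub>C T (P x))"
    by (simp add: fun_eq_iff P_def bounded_clinear_diff[OF T] flip: B(2))
  hence "quasinilpotent_on {x. P x = x} T"
    using qn quasinilpotent_compress_iff[OF T P PP PT, of "-1"] by simp
  ultimately show "\<exists>(M, N) \<in> Red T. bij_betw T M M \<and> quasinilpotent_on N T"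
    using Red by blast
next
  assume "\<exists>(M, N) \<in> Red T. bij_betw T M M \<and> quasinilpotent_on N T"
  then obtain M N where MN: "(M, N) \<in> Red T" and bij: "bij_betw T M M"
    and qn: "quasinilpotent_on N T"
    by blast
  from T MN obtain P where P: "bounded_clinear P" "\<And>x. P (P x) = P x" "\<And>x. P (T x) = T (P x)"
    and M: "M = {x. P x = 0}" and N: "N = {x. P x = x}"
    and M_sub: "complex_vector.subspace M" and M_cl: "closed M"
    by (rule RedE) blast
  obtain c where c: "c > 0" "\<And>x. x \<in> M \<Longrightarrow> c * norm x \<le> norm (T x)"
    using bij_betw_bounded_below[OF T M_sub M_cl bij] by blast
  define B where "B x = inv_into M T (x - P x)" for x
  have proj_M: "x - P x \<in> M" for x by (simp add: M bounded_clinear_diff[OF P(1)] P(2))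
  have B_M: "B x \<in> M" and TB: "T (B x) = x - P x" for x
    unfolding B_def using proj_M[of x] bij
    by (simp_all add: bij_betw_def inv_into_into f_inv_into_f)
  have B_eq: "B x = y" if "y \<in> M" "T y = x - P x" for x y
    using that bij B_M TB by (metis bij_betw_inv_into_left)
  have add: "B (x + y) = B x + B y" for x y
    by (intro B_eq complex_vector.subspace_add[OF M_sub] B_M)
      (simp add: bounded_clinear_add[OF T] bounded_clinear_add[OF P(1)] TB)
  have scale: "B (a *\<^sub>C x) = a *\<^sub>C B x" for a x
    by (intro B_eq complex_vector.subspace_scale[OF M_sub] B_M)
      (simp add: bounded_clinear_scaleC[OF T] bounded_clinear_scaleC[OF P(1)] TB
        complex_vector.scale_right_diff_distrib)
  obtain K where K: "K > 0" "\<And>x. norm (x - P x) \<le> norm x * K"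
    using bounded_linear.pos_bounded[OF bounded_clinear_bounded_linear[OF
          bounded_clinear_sub[OF bounded_clinear_ident P(1)]]] by blast
  have "bounded_linear B"
  proof (rule bounded_linear_intro[OF add])
    show "B (r *\<^sub>R x) = r *\<^sub>R B x" for r x
      using scale by (simp flip: scaleC_of_real)
    show "norm (B x) \<le> norm x * (K / c)" for x
    proof -
      have "c * norm (B x) \<le> norm x * K"
        using c(2)[OF B_M[of x]] K(2)[of x] TB[of x] by simp
      thus ?thesis using c(1) by (simp add: field_simps)
    qed
  qed
  hence B: "bounded_clinear B" using scale by (simp add: bounded_clinear_def)
  have BT: "B (T x) = x - P x" for x
    by (rule B_eq[OF proj_M]) (simp add: bounded_clinear_diff[OF T] P(3))
  have PB: "P (B x) = 0" for x using B_M[of x] by (simp add: M)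
  \<comment> \<open>This is the identity \<open>B T B = B\<close>, as
    \<open>T (B x) = x - P x\<close>.\<close>
  have "B (x - P x) = B x" for x
    using BT[of "B x"] by (simp add: PB TB)
  moreover have "(\<lambda>x. T (B (T x)) - T x) = (\<lambda>x. (-1) *\<^sub>C T (P x))"
    by (simp add: fun_eq_iff BT bounded_clinear_diff[OF T])
  moreover have "quasinilpotent_on UNIV (\<lambda>x. (-1) *\<^sub>C T (P x))"
    using qn quasinilpotent_compress_iff[OF T P, of "-1"] N by simp
  ultimately show "generalized_Drazin_invertible T"
    unfolding generalized_Drazin_invertible_def using B
    by (intro exI[of _ B]) (simp add: fun_eq_iff TB BT)
qed

section \<open>The spectra near 0 and the equivalences\<close>

lemma Browder_spectrum_subset_spectrum:
  assumes T: "bounded_clinear T"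
  shows "Browder_spectrum T \<subseteq> spectrum T"
proof -
  have "Browder_on UNIV (\<lambda>x. T x - \<mu> *\<^sub>C x)" if "invertible_op (\<lambda>x. T x - \<mu> *\<^sub>C x)" for \<mu>
    using that bij_betw_imp_Browder_on[OF bounded_clinear_shift[OF T]
        complex_vector.subspace_UNIV closed_UNIV]
    by (simp add: invertible_op_iff_bij[OF bounded_clinear_shift[OF T]])
  thus ?thesis by (auto simp: Browder_spectrum_def spectrum_def)
qed

lemma not_islimpt_spectrum:
  assumes T: "bounded_clinear T" and MN: "(M, N) \<in> Red T" and bij: "bij_betw T M M"
    and qn: "quasinilpotent_on N T"
  shows "\<not> 0 islimpt spectrum T"
proof -
  from T MN have M: "complex_vector.subspace M" "closed M"
    and N: "complex_vector.subspace N" "closed N" "T ` N \<subseteq> N"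
    by (auto simp: Red_def)
  obtain c where c: "c > 0" "\<And>x. x \<in> M \<Longrightarrow> c * norm x \<le> norm (T x)"
    using bij_betw_bounded_below[OF T M bij] by blast
  \<comment> \<open>The lower bound of \<open>T\<close> on \<open>M\<close> is the radius of a
    punctured disc free of spectrum; \<open>N\<close> only excludes the centre.\<close>
  have "\<mu> \<notin> spectrum T" if "\<mu> \<noteq> 0" "cmod \<mu> < c" for \<mu>
  proof -
    have "bij (\<lambda>x. T x - \<mu> *\<^sub>C x)"
      using bij_betw_shift[OF T M bij c(2) that(2)] quasinilpotent_bij_betw_shift[OF T N qn that(1)]
      by (rule bij_betw_Red[OF T MN bounded_clinear_shift[OF T]])
    thus ?thesis
      by (simp add: spectrum_def invertible_op_iff_bij[OF bounded_clinear_shift[OF T]])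
  qed
  thus ?thesis
    unfolding islimpt_approachable using c(1) by (auto simp: dist_norm)
qed

theorem theorem3p7:
  fixes T :: "'a::complex_banach \<Rightarrow> 'a"
  assumes infinite_dim: "\<not> finite_dim (UNIV :: 'a set)"
    and T: "bounded_clinear T"
  shows
    "(generalized_Drazin_invertible T \<longleftrightarrow>
        generalized_Kato_decomposable T \<and> 0 \<notin> interior (spectrum T)) \<and>
     (generalized_Drazin_invertible T \<longleftrightarrow>
        generalized_Kato_decomposable T \<and> 0 \<notin> interior (Browder_spectrum T)) \<and>
     (generalized_Drazin_invertible T \<longleftrightarrow>
        generalized_Kato_decomposable T \<and> \<not> 0 islimpt Browder_spectrum T) \<and>
     (generalized_Drazin_invertible T \<longleftrightarrow>
        (\<exists>(M, N) \<in> Red T. Browder_on M T \<and> quasinilpotent_on N T)) \<and>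
     (generalized_Drazin_invertible T \<longleftrightarrow>
        (\<exists>P. bounded_clinear P \<and> P \<circ> P = P \<and> P \<circ> T = T \<circ> P \<and>
             Browder_on UNIV (\<lambda>x. T x + P x) \<and> quasinilpotent_on UNIV (T \<circ> P)))"
proof -
  let ?D = "generalized_Drazin_invertible T"
  let ?vi = "\<exists>P. bounded_clinear P \<and> P \<circ> P = P \<and> P \<circ> T = T \<circ> P \<and>
    Browder_on UNIV (\<lambda>x. T x + P x) \<and> quasinilpotent_on UNIV (T \<circ> P)"
  note D_iff = generalized_Drazin_invertible_iff_Red[OF T]
  note sub = Browder_spectrum_subset_spectrum[OF T]
  \<comment> \<open>The claim on the full spectrum is stronger than (ii), (iii) and (iv) require;
    they follow from it by inclusion of the spectra.\<close>
  have from_D: "generalized_Kato_decomposable T \<and> \<not> 0 islimpt spectrum T \<and>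
      (\<exists>(M, N) \<in> Red T. Browder_on M T \<and> quasinilpotent_on N T) \<and> ?vi" if D: ?D
  proof -
    obtain M N where MN: "(M, N) \<in> Red T" and bij: "bij_betw T M M" and qn: "quasinilpotent_on N T"
      using D unfolding D_iff by blast
    from T MN obtain P where P: "bounded_clinear P" "\<And>x. P (P x) = P x" "\<And>x. P (T x) = T (P x)"
      and M: "M = {x. P x = 0}" and N: "N = {x. P x = x}"
      and M': "complex_vector.subspace M" "closed M"
      and N': "complex_vector.subspace N" "closed N" "T ` N \<subseteq> N"
      by (rule RedE) blast
    have zero: "0 \<in> M" by (rule complex_vector.subspace_0[OF M'(1)])
    have "Browder_on M T" by (rule bij_betw_imp_Browder_on[OF T M' bij])
    moreover have "Kato_on M T"
    proof -
      have im: "T ` M = M" using bij by (rule bij_betw_imp_surj_on)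
      have ker: "kernel_on M T \<subseteq> {0}"
        using bij zero bounded_clinear_zero[OF T] by (auto simp: kernel_on_def bij_betw_def inj_on_def)
      have "0 \<in> (T ^^ n) ` M" for n
        using bounded_clinear_zero[OF bounded_clinear_funpow[OF T], of n] zero by (metis imageI)
      thus ?thesis using ker M'(2) by (auto simp: Kato_on_def im)
    qed
    moreover have ?vi
    proof (intro exI[of _ P] conjI P(1))
      have TP: "bounded_clinear (\<lambda>x. T x + P x)" by (rule bounded_clinear_sum[OF T P(1)])
      \<comment> \<open>On \<open>N\<close> the operator \<open>T + P\<close> is
        \<open>T + 1\<close>, the shift by -1; on \<open>M\<close> it is \<open>T\<close>.\<close>
      have "bij_betw (\<lambda>x. T x - (-1) *\<^sub>C x) N N"
        by (rule quasinilpotent_bij_betw_shift[OF T N' qn]) simp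
      hence "bij_betw (\<lambda>x. T x + P x) N N"
        by (rule bij_betw_cong[THEN iffD1, rotated]) (simp add: N)
      moreover have "bij_betw (\<lambda>x. T x + P x) M M"
        using bij by (rule bij_betw_cong[THEN iffD1, rotated]) (simp add: M)
      ultimately have "bij (\<lambda>x. T x + P x)" by (intro bij_betw_Red[OF T MN TP])
      thus "Browder_on UNIV (\<lambda>x. T x + P x)"
        by (intro bij_betw_imp_Browder_on TP) simp_all
      show "quasinilpotent_on UNIV (T \<circ> P)"
        using qn quasinilpotent_compress_iff[OF T P, of 1] by (simp add: N o_def)
    qed (simp_all add: fun_eq_iff P)
    ultimately show ?thesis
      using MN qn not_islimpt_spectrum[OF T MN bij qn]
      by (auto simp: generalized_Kato_decomposable_def)
  qed
  have to_D: ?D if "(M, N) \<in> Red T" "quasinilpotent_on N T" "asc_on M T < \<infinity>" "dsc_on M T < \<infinity>"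
    for M N
    unfolding D_iff by (rule Red_bij_quasinilpotent[OF T that])
  \<comment> \<open>Condition (iii) is the weakest of the three spectral conditions, so (ii) and
    (iv) are reduced to it.\<close>
  have iii_D: ?D if Kato: "generalized_Kato_decomposable T" and int: "0 \<notin> interior (Browder_spectrum T)"
  proof -
    obtain M N where MN: "(M, N) \<in> Red T" and Kato_M: "Kato_on M T" and qn: "quasinilpotent_on N T"
      using Kato unfolding generalized_Kato_decomposable_def by blast
    from T MN obtain P where P: "bounded_clinear P" "\<And>x. P (P x) = P x" "\<And>x. P (T x) = T (P x)"
      and M: "M = {x. P x = 0}"
      and M': "complex_vector.subspace M" "closed M" "T ` M \<subseteq> M"
      by (rule RedE) blast
    have "bij_betw T M M"
    proof (rule Kato_bij_betw[OF T M' Kato_M])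
      fix e :: real assume "e > 0"
      then obtain \<mu> where "\<mu> \<in> ball 0 e" "\<mu> \<notin> Browder_spectrum T"
        using int by (metis mem_interior subsetI)
      hence \<mu>: "cmod \<mu> < e" "Browder_on UNIV (\<lambda>x. T x - \<mu> *\<^sub>C x)"
        by (auto simp: Browder_spectrum_def)
      have comm: "P (T x - \<mu> *\<^sub>C x) = T (P x) - \<mu> *\<^sub>C P x" for x
        by (simp add: bounded_clinear_diff[OF P(1)] bounded_clinear_scaleC[OF P(1)] P(3))
      have "asc_on M (\<lambda>x. T x - \<mu> *\<^sub>C x) < \<infinity>" "dsc_on M (\<lambda>x. T x - \<mu> *\<^sub>C x) < \<infinity>"
        unfolding M
        using asc_dsc_on_summand[where P = P and A = "\<lambda>x. T x - \<mu> *\<^sub>C x",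
            OF bounded_clinear_shift[OF T] P(1,2) comm refl \<mu>(2)]
        by simp_all
      thus "\<exists>\<mu>. cmod \<mu> < e \<and> asc_on M (\<lambda>x. T x - \<mu> *\<^sub>C x) < \<infinity> \<and>
          dsc_on M (\<lambda>x. T x - \<mu> *\<^sub>C x) < \<infinity>"
        using \<mu>(1) by (intro exI[of _ \<mu>] conjI)
    qed
    thus ?D unfolding D_iff using MN qn by blast
  qed
  have v_D: ?D if v: "\<exists>(M, N) \<in> Red T. Browder_on M T \<and> quasinilpotent_on N T"
  proof -
    obtain M N where "(M, N) \<in> Red T" "Browder_on M T" "quasinilpotent_on N T"
      using v by blast
    thus ?D by (intro to_D[of M N])
      (simp_all add: Browder_on_def upper_semi_Browder_on_def lower_semi_Browder_on_def)
  qed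
  have vi_D: ?D if vi: ?vi
  proof -
    obtain P where P: "bounded_clinear P" "\<And>x. P (P x) = P x" "\<And>x. P (T x) = T (P x)"
      and Browder: "Browder_on UNIV (\<lambda>x. T x + P x)" and qn: "quasinilpotent_on UNIV (\<lambda>x. T (P x))"
      using vi by (auto simp: fun_eq_iff o_def)
    have "({x. P x = 0}, {x. P x = x}) \<in> Red T"
      unfolding Red_iff_projection[OF T] by (intro exI[of _ P]) (simp add: P fun_eq_iff)
    moreover have "quasinilpotent_on {x. P x = x} T"
      using qn quasinilpotent_compress_iff[OF T P, of 1] by simp
    moreover have comm: "P (T x + P x) = T (P x) + P (P x)" for x
      by (simp add: bounded_clinear_add[OF P(1)] P(3))
    \<comment> \<open>Where \<open>P\<close> vanishes, \<open>T + P\<close> coincides with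
      \<open>T\<close>, so \<open>T\<close> inherits finite ascent and descent there.\<close>
    have "asc_on {x. P x = 0} T < \<infinity>" "dsc_on {x. P x = 0} T < \<infinity>"
      using asc_dsc_on_summand[where P = P and A = "\<lambda>x. T x + P x" and S = T,
          OF bounded_clinear_sum[OF T P(1)] P(1,2) comm _ Browder]
      by simp_all
    ultimately show ?D by (intro to_D)
  qed
  \<comment> \<open>The complex plane has no isolated points, so interior points are accumulation
    points.\<close>
  have limpt: "0 \<notin> interior A" if "\<not> 0 islimpt A" for A :: "complex set"
    using that interior_limit_point by blast
  have limpt_mono: "\<not> 0 islimpt Browder_spectrum T" if "\<not> 0 islimpt spectrum T"
    using that islimpt_subset[OF _ sub] by blast
  have int_mono: "0 \<notin> interior (Browder_spectrum T)" if "0 \<notin> interior (spectrum T)"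
    using that interior_mono[OF sub] by blast
  have "?D \<longleftrightarrow> generalized_Kato_decomposable T \<and> 0 \<notin> interior (spectrum T)"
    using from_D limpt iii_D int_mono by blast
  moreover have "?D \<longleftrightarrow> generalized_Kato_decomposable T \<and> 0 \<notin> interior (Browder_spectrum T)"
    using from_D limpt iii_D int_mono by blast
  moreover have "?D \<longleftrightarrow> generalized_Kato_decomposable T \<and> \<not> 0 islimpt Browder_spectrum T"
    using from_D limpt limpt_mono iii_D by blast
  moreover have "?D \<longleftrightarrow> (\<exists>(M, N) \<in> Red T. Browder_on M T \<and> quasinilpotent_on N T)"
    using from_D v_D by (intro iffI) simp_all
  moreover have "?D \<longleftrightarrow> ?vi"
    using from_D vi_D by (intro iffI) simp_all
  ultimately show ?thesis by (intro conjI)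
qed

end
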